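(* Let $R>0$ and let $l$ be a continuous function on $\mathbb{R}$ with $l(-x)=\overline{l(x)}$ and compact support contained in $[-R,R]$. Let $\sigma$ be the purely absolutely continuous measure on $\mathbb{R}$ with density given by $$2\pi\sigma'(\lambda)=\exp\left(\int_{\mathbb{R}}l(x)e^{i\lambda x}dx\right),$$ and let $A$ be the (continuous) coefficient of the Krein system with spectral measure $\sigma$. For large $n$ let $h=R/n$, $x_j=jh$ ($j=-n,\dots,n$), and let $\mu_n$ be the absolutely continuous measure on the unit circle $\mathbb{T}$ with density $$\mu_n'(\theta)=\exp\left[\sum_{j=-n}^nh\,l(x_j)z^j\right],\qquad z=e^{i\theta}.$$ Let $a^{(h)}_j$, $j\ge0$, be the Verblunsky parameters of $\mu_n$. Then for any small fixed $\delta>0$ $$\lim_{h\to0}\ \sup_{\delta<jh<R}\left|A(jh)-h^{-1}a^{(h)}_j\right|=0 .$$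
   Context: Verblunsky parameters: if $P_n$ are the monic orthogonal polynomials of a positive measure on $\mathbb{T}$ with infinite support and $P_n^*(z)=z^n\overline{P_n(\bar z^{-1})}$, then the Verblunsky parameters $a_n$ are defined by $P_{n+1}(z)=zP_n(z)-\bar a_nP_n^*(z)$, $P_0=1$ (they do not depend on multiplying the measure by a positive constant). Krein system with spectral measure $\sigma$: a Hermitian function $H$ ($H(-x)=\overline{H(x)}$) is an accelerant if $I+\mathcal{H}_r>0$ on $L^2[0,r]$ for every $r>0$, where $(\mathcal{H}_rf)(x)=\int_0^rH(x-t)f(t)dt$. The accelerant $H$ corresponds to the measure $\sigma$ if for some $\beta\in\mathbb{R}$ and all $x\in\mathbb{R}$ $$\frac{|x|}{2}+\int_0^x(x-s)H(s)ds=i\beta x+\int_{-\infty}^\infty\left(1+\frac{i\lambda x}{1+\lambda^2}-e^{i\lambda x}\right)\frac{d\sigma(\lambda)}{\lambda^2}.$$ For the measure $\sigma$ in the claim this holds with a unique continuous accelerant, namely $\overline{H}=l+\frac{l*l}{2!}+\frac{l*l*l}{3!}+\cdots$. The coefficient of the Krein system $P'=i\lambda P-\overline{A}P_*$, $P_*'=-AP$, $P(0)=P_*(0)=1$, is $A(r)=\Gamma_r(0,r)$, where the resolvent kernel $\Gamma_r$ satisfies $\Gamma_r(t,s)+\int_0^rH(t-u)\Gamma_r(u,s)du=H(t-s)$, $0\le s,t\le r$; it is continuous on $[0,\infty)$. The limit $h\to0$ means $n\to\infty$ with $R$ fixed; $j$ is an integer. *)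

theory Defs
  imports "HOL-Analysis.Analysis" "HOL-Computational_Algebra.Polynomial"
begin

definition hermitian_fun :: "(real \<Rightarrow> complex) \<Rightarrow> bool" where
  "hermitian_fun H \<longleftrightarrow> (\<forall>x. H (- x) = cnj (H x))"


section \<open>Verblunsky parameters\<close>

definition measure_support :: "complex measure \<Rightarrow> complex set" where
  "measure_support \<mu> = {z. \<forall>e>0. emeasure \<mu> (ball z e) > 0}"

definition nontrivial_circle_measure :: "complex measure \<Rightarrow> bool" where
  "nontrivial_circle_measure \<mu> \<longleftrightarrow>
     finite_measure \<mu> \<and> sets \<mu> = sets borel \<and>
     emeasure \<mu> (- sphere 0 1) = 0 \<and> infinite (measure_support \<mu>)"

definition monic_orthogonal_polys :: "complex measure \<Rightarrow> (nat \<Rightarrow> complex poly) \<Rightarrow> bool" where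
  "monic_orthogonal_polys \<mu> P \<longleftrightarrow>
     (\<forall>n. degree (P n) = n \<and> lead_coeff (P n) = 1 \<and>
          (\<forall>k<n. (LINT z|\<mu>. poly (P n) z * cnj (z ^ k)) = 0))"

definition reversed_poly :: "nat \<Rightarrow> complex poly \<Rightarrow> complex \<Rightarrow> complex" where
  "reversed_poly n p z = z ^ n * cnj (poly p (inverse (cnj z)))"

text \<open>The formula defining \<open>reversed_poly\<close> makes sense only away from \<open>0\<close>; an identity between
  polynomials is determined by its values there.\<close>

definition verblunsky_parameters :: "complex measure \<Rightarrow> (nat \<Rightarrow> complex) \<Rightarrow> bool" where
  "verblunsky_parameters \<mu> a \<longleftrightarrow>
     nontrivial_circle_measure \<mu> \<and>
     (\<exists>P. monic_orthogonal_polys \<mu> P \<and>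
          (\<forall>n z. z \<noteq> 0 \<longrightarrow>
             poly (P (Suc n)) z = z * poly (P n) z - cnj (a n) * reversed_poly n (P n) z))"

definition circle_measure_with_density :: "(real \<Rightarrow> real) \<Rightarrow> complex measure" where
  "circle_measure_with_density w =
     distr (density lborel (\<lambda>\<theta>. ennreal (w \<theta>) * indicator {0..<2*pi} \<theta>)) borel cis"


section \<open>Krein systems\<close>

definition L2_on :: "real set \<Rightarrow> (real \<Rightarrow> complex) \<Rightarrow> bool" where
  "L2_on S f \<longleftrightarrow>
     set_borel_measurable lborel S f \<and> set_integrable lborel S (\<lambda>x. (cmod (f x))\<^sup>2)"

definition conv_op :: "(real \<Rightarrow> complex) \<Rightarrow> real \<Rightarrow> (real \<Rightarrow> complex) \<Rightarrow> real \<Rightarrow> complex" where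
  "conv_op H r f x = (LINT t:{0..r}|lborel. H (x - t) * f t)"

text \<open>The quadratic form below is real because \<open>H\<close> is Hermitian, so that taking the real part
  discards nothing.\<close>

definition accelerant :: "(real \<Rightarrow> complex) \<Rightarrow> bool" where
  "accelerant H \<longleftrightarrow>
     hermitian_fun H \<and> (\<forall>r>0. set_integrable lborel {- r..r} H) \<and>
     (\<forall>r>0. \<forall>f. L2_on {0..r} f \<longrightarrow> \<not> (AE x in lborel. x \<in> {0..r} \<longrightarrow> f x = 0) \<longrightarrow>
        Re (LINT x:{0..r}|lborel. (f x + conv_op H r f x) * cnj (f x)) > 0)"

text \<open>The value at \<open>\<xi> = 0\<close> is the limit of the expression in the other branch.\<close>

definition krein_kernel :: "real \<Rightarrow> real \<Rightarrow> complex" where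
  "krein_kernel x \<xi> =
     (if \<xi> = 0 then of_real (x\<^sup>2 / 2)
      else (1 + \<i> * of_real (\<xi> * x) / of_real (1 + \<xi>\<^sup>2) - exp (\<i> * of_real (\<xi> * x)))
             / of_real (\<xi>\<^sup>2))"

definition accelerant_corresponds :: "(real \<Rightarrow> complex) \<Rightarrow> real measure \<Rightarrow> bool" where
  "accelerant_corresponds H \<sigma> \<longleftrightarrow>
     sets \<sigma> = sets borel \<and> integrable \<sigma> (\<lambda>\<xi>. 1 / (1 + \<xi>\<^sup>2)) \<and>
     (\<exists>\<beta>::real. \<forall>x::real.
        of_real (\<bar>x\<bar> / 2) + (LBINT s=0..ereal x. of_real (x - s) * H s)
          = \<i> * of_real (\<beta> * x) + (LINT \<xi>|\<sigma>. krein_kernel x \<xi>))"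

definition resolvent_kernel ::
  "(real \<Rightarrow> complex) \<Rightarrow> real \<Rightarrow> (real \<Rightarrow> real \<Rightarrow> complex) \<Rightarrow> bool" where
  "resolvent_kernel H r \<Gamma> \<longleftrightarrow>
     continuous_on ({0..r} \<times> {0..r}) (\<lambda>(t, s). \<Gamma> t s) \<and>
     (\<forall>t\<in>{0..r}. \<forall>s\<in>{0..r}.
        \<Gamma> t s + (LINT u:{0..r}|lborel. H (t - u) * \<Gamma> u s) = H (t - s))"

text \<open>\<open>A\<close> is the coefficient in \<open>P' = i \<xi> P - cnj A P\<^sub>*\<close>, \<open>P\<^sub>*' = - A P\<close>; only its values on
  the half-line \<open>[0, \<infinity>)\<close> matter.\<close>

definition krein_coefficient :: "real measure \<Rightarrow> (real \<Rightarrow> complex) \<Rightarrow> bool" where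
  "krein_coefficient \<sigma> A \<longleftrightarrow>
     (\<exists>H. continuous_on UNIV H \<and> accelerant H \<and> accelerant_corresponds H \<sigma> \<and>
          (\<forall>r\<ge>0. \<exists>\<Gamma>. resolvent_kernel H r \<Gamma> \<and> A r = \<Gamma> 0 r))"


section \<open>The line measure and its discretization\<close>

text \<open>For Hermitian \<open>l\<close> both exponents below are real, so \<open>Re\<close> only changes the type.\<close>

definition exp_line_measure :: "(real \<Rightarrow> complex) \<Rightarrow> real measure" where
  "exp_line_measure l =
     density lborel
       (\<lambda>\<xi>. ennreal (Re (exp (LINT x|lborel. l x * exp (\<i> * of_real (\<xi> * x)))) / (2 * pi)))"

definition exp_circle_measure :: "(real \<Rightarrow> complex) \<Rightarrow> real \<Rightarrow> nat \<Rightarrow> complex measure" where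
  "exp_circle_measure l R n =
     (let h = R / real n in
      circle_measure_with_density
        (\<lambda>\<theta>. Re (exp (\<Sum>j\<in>{- int n..int n}.
                 of_real h * l (of_int j * h) * cis \<theta> powi j))))"

end

theory Submission
  imports Defs "HOL-Probability.Sinc_Integral" "HOL-Probability.Characteristic_Functions"
begin

text \<open>The normalized moments of \<open>\<mu>\<^sub>n\<close> are \<open>\<delta>\<^sub>k\<^sub>0 + h L\<^sub>n(kh)\<close>, where \<open>L\<^sub>n\<close> is the exponential series of \<open>l\<close> with
  convolutions replaced by Riemann sums, so \<open>L\<^sub>n\<close> tends uniformly to \<open>L = l + l*l/2! + \<dots>\<close>. Taking second
  differences in \<open>x\<close> of the relation between accelerant and spectral measure removes \<open>\<beta>\<close> and turns the
  kernel into the Fejer kernel, whose transform is a tent function; hence \<open>H\<close> is the conjugate of \<open>L\<close>.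
  Orthogonality of \<open>P\<^sub>j\<^sub>+\<^sub>1\<close> says that its coefficients divided by \<open>-h\<close> solve the discretization of the
  conjugated resolvent equation at \<open>r = jh\<close>, and its constant coefficient is minus the conjugate of \<open>a\<^sub>j\<close>.
  The discretized equations are stable uniformly in \<open>h\<close> and \<open>r\<close> because the density of \<open>\<mu>\<^sub>n\<close> is bounded
  below by \<open>exp(-3RM)\<close>, \<open>M = max |l|\<close>; the same bound, in the limit, makes the resolvent kernels bounded
  and equicontinuous uniformly in \<open>r\<close>, so the discretization error is uniformly small.\<close>

section \<open>Riemann sums, exponential series and the Fejer kernel\<close>

text \<open>On the line the comparison is made weakly, against Fejer kernels, because the density of
  the spectral measure is bounded below and so is not integrable; the decay of the Fejer kernel
  makes the termwise expansion of the exponential absolutely convergent. The moments carry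
  exp(-ik\<theta>) whereas the Krein kernel carries exp(i\<xi>x), so \<open>L\<close> appears
  reflected on the line; Hermitian symmetry turns the reflection into the conjugation mentioned
  above. The obstacle is uniformity: the size of the linear systems grows with \<open>n\<close>, and
  a Verblunsky parameter is a single coordinate that is still to be divided by \<open>h\<close>, so
  a mean-square estimate alone is too weak. A sup estimate survives because (number of unknowns)
  times \<open>h\<close> never exceeds \<open>2 * R\<close>. The discretization is off by one in two
  places. The lower coefficients of P_{j+1} sit at 0, h, ..., jh, so the sum has a full-weight node
  at the right end r = jh; the leading coefficient sits at (j+1)h, so the right-hand side is shifted
  by one mesh. The first is absorbed by boundedness and the second by uniform continuity of
  \<open>L\<close>.\<close>

lemma mesh_index:
  assumes h: "h > 0" and r: "0 \<le> (r::real)"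
  obtains j where "real j * h \<le> r" "r < real (Suc j) * h"
proof
  have "of_int \<lfloor>r / h\<rfloor> \<le> r / h" "r / h < of_int \<lfloor>r / h\<rfloor> + 1" by linarith+
  then have "of_int \<lfloor>r / h\<rfloor> * h \<le> r" "r < (of_int \<lfloor>r / h\<rfloor> + 1) * h"
    by (simp_all only: pos_le_divide_eq[OF h] pos_divide_less_eq[OF h])
  moreover have "real (nat \<lfloor>r / h\<rfloor>) = of_int \<lfloor>r / h\<rfloor>" using h r by simp
  ultimately show "real (nat \<lfloor>r / h\<rfloor>) * h \<le> r" "r < real (Suc (nat \<lfloor>r / h\<rfloor>)) * h"
    by (simp_all only: of_nat_Suc add.commute)
qed

text \<open>The upper limit \<open>r\<close> need not be a grid point. Complete cells are sampled at
  their left end and contribute the oscillation \<open>e\<close>. The last node has weight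
  \<open>h\<close> although only r - jh, between 0 and \<open>h\<close>, is left of the interval;
  this mismatch is the term \<open>h * B\<close>.\<close>

lemma riemann_sum_error:
  fixes g :: "real \<Rightarrow> complex"
  assumes h: "h > 0" and j: "real j * h \<le> r" "r \<le> real (Suc j) * h"
    and cont: "continuous_on {0..r} g"
    and bound: "\<And>u. u \<in> {0..r} \<Longrightarrow> cmod (g u) \<le> B"
    and osc: "\<And>u v. u \<in> {0..r} \<Longrightarrow> v \<in> {0..r} \<Longrightarrow> \<bar>u - v\<bar> \<le> h \<Longrightarrow> cmod (g u - g v) \<le> e"
  shows "cmod (integral {0..r} g - (\<Sum>i\<le>j. of_real h * g (real i * h))) \<le> r * e + h * B"
proof -
  have piece: "cmod (integral {a..b} g - of_real (b - a) * g a) \<le> e * (b - a)"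
    if "0 \<le> a" "a \<le> b" "b \<le> r" "b - a \<le> h" for a b
  proof -
    have c: "continuous_on {a..b} g" using cont that by (auto intro: continuous_on_subset)
    have "integral {a..b} (\<lambda>u. g u - g a) = integral {a..b} g - of_real (b - a) * g a"
      using that by (subst integral_diff) (auto intro: integrable_continuous_real c simp: scaleR_conv_of_real)
    moreover have "cmod (integral {a..b} (\<lambda>u. g u - g a)) \<le> e * (b - a)"
      using that by (intro integral_bound) (auto intro!: continuous_intros c osc)
    ultimately show ?thesis by simp
  qed
  have prefix: "cmod (integral {0..real i * h} g - (\<Sum>k<i. of_real h * g (real k * h))) \<le> real i * h * e"
    if "i \<le> j" for i
    using that
  proof (induction i)
    case (Suc i)
    have le: "real (Suc i) * h \<le> r"
      using Suc.prems h j(1) by (meson mult_right_mono of_nat_le_iff less_imp_le order_trans)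
    have eq: "integral {0..real (Suc i) * h} g = integral {0..real i * h} g + integral {real i * h..real (Suc i) * h} g"
      using le h by (intro Henstock_Kurzweil_Integration.integral_combine[symmetric] integrable_continuous_real)
        (auto intro!: continuous_on_subset[OF cont] mult_right_mono)
    have "cmod (integral {real i * h..real (Suc i) * h} g - of_real (real (Suc i) * h - real i * h) * g (real i * h))
            \<le> e * (real (Suc i) * h - real i * h)"
      using le h by (intro piece) (auto simp: algebra_simps)
    then have "cmod (integral {real i * h..real (Suc i) * h} g - of_real h * g (real i * h)) \<le> e * h"
      by (simp add: algebra_simps)
    with Suc have "cmod ((integral {0..real i * h} g - (\<Sum>k<i. of_real h * g (real k * h)))
       + (integral {real i * h..real (Suc i) * h} g - of_real h * g (real i * h))) \<le> real i * h * e + e * h"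
      by (intro norm_triangle_mono) auto
    then show ?case unfolding eq by (simp add: algebra_simps)
  qed simp
  have r: "0 \<le> real j * h" using h by simp
  have eq: "integral {0..r} g = integral {0..real j * h} g + integral {real j * h..r} g"
    using h j by (intro Henstock_Kurzweil_Integration.integral_combine[symmetric] integrable_continuous_real cont) auto
  let ?x = "real j * h"
  have "(\<Sum>i\<le>j. of_real h * g (real i * h)) = (\<Sum>k<j. of_real h * g (real k * h)) + of_real h * g ?x"
    by (simp flip: lessThan_Suc_atMost)
  then have "integral {0..r} g - (\<Sum>i\<le>j. of_real h * g (real i * h))
     = (integral {0..?x} g - (\<Sum>k<j. of_real h * g (real k * h)))
       + ((integral {?x..r} g - of_real (r - ?x) * g ?x) + of_real (r - ?x - h) * g ?x)"
    unfolding eq by (simp add: algebra_simps)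
  also have "cmod \<dots> \<le> ?x * e + (e * (r - ?x) + h * B)"
  proof (intro norm_triangle_mono prefix order_refl piece)
    have "\<bar>r - ?x - h\<bar> \<le> h" using j h by (simp add: algebra_simps abs_le_iff)
    then show "cmod (of_real (r - ?x - h) * g ?x) \<le> h * B"
      unfolding norm_mult norm_of_real using j r h by (intro mult_mono bound) auto
  qed (use j r h in \<open>auto simp: algebra_simps\<close>)
  finally show ?thesis by (simp add: algebra_simps)
qed

text \<open>Boundedness of \<open>q\<close> gives the summable majorant |F| N^m / m!. The lemma
  serves twice: on the circle, with \<open>F\<close> a character and \<open>q\<close> the
  trigonometric exponent, and on the line, with \<open>F\<close> a modulated Fejer kernel and
  \<open>q\<close> the transform of \<open>l\<close>.\<close>

lemma integral_exp_series:
  fixes F q :: "'a \<Rightarrow> complex"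
  assumes F: "integrable M F" and q[measurable]: "q \<in> borel_measurable M"
    and N: "\<And>x. cmod (q x) \<le> N"
  shows "(\<lambda>m. (LINT x|M. F x * q x ^ m) / fact m) sums (LINT x|M. F x * exp (q x))"
proof -
  have [measurable]: "F \<in> borel_measurable M" using F by auto
  have N0: "0 \<le> N" using N[of undefined] norm_ge_zero order_trans by blast
  have i: "integrable M (\<lambda>x. F x * q x ^ m / fact m)" for m
  proof (rule Bochner_Integration.integrable_bound)
    show "integrable M (\<lambda>x. N ^ m * cmod (F x))" using F by auto
    show "AE x in M. norm (F x * q x ^ m / fact m) \<le> norm (N ^ m * cmod (F x))"
    proof (rule AE_I2)
      fix x
      have "cmod (F x) * cmod (q x) ^ m / fact m \<le> cmod (F x) * cmod (q x) ^ m / 1"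
        by (intro divide_left_mono) (auto simp: fact_ge_1)
      also have "\<dots> \<le> N ^ m * cmod (F x)" using power_mono[OF N[of x] norm_ge_zero, of m] by (simp add: mult.commute[of "N ^ m"] mult_left_mono)
      finally show "norm (F x * q x ^ m / fact m) \<le> norm (N ^ m * cmod (F x))"
        using N0 by (simp add: norm_mult norm_divide norm_power)
    qed
  qed measurable
  have ex: "(\<lambda>m. F x * q x ^ m / fact m) sums (F x * exp (q x))" for x
    using sums_mult[OF exp_converges[of "q x"], of "F x"]
    by (simp add: scaleR_conv_of_real field_simps)
  have "(\<lambda>m. LINT x|M. F x * q x ^ m / fact m) sums (LINT x|M. (\<Sum>m. F x * q x ^ m / fact m))"
  proof (rule sums_integral[OF i])
    show "AE x in M. summable (\<lambda>m. norm (F x * q x ^ m / fact m))"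
    proof (rule AE_I2)
      fix x
      show "summable (\<lambda>m. norm (F x * q x ^ m / fact m))"
      proof -
        have "norm (F x * q x ^ m / fact m) = cmod (F x) * (inverse (fact m) * cmod (q x) ^ m)" for m
          by (simp add: norm_mult norm_divide norm_power divide_inverse norm_inverse)
        then show ?thesis using summable_mult[OF summable_exp[of "cmod (q x)"], of "cmod (F x)"] by simp
      qed
    qed
    have bnd: "(LINT x|M. norm (F x * q x ^ m / fact m)) \<le> (LINT x|M. cmod (F x)) * (N ^ m / fact m)" for m
    proof -
      have "(LINT x|M. norm (F x * q x ^ m / fact m)) \<le> (LINT x|M. cmod (F x) * (N ^ m / fact m))"
      proof (rule integral_mono)
        show "norm (F x * q x ^ m / fact m) \<le> cmod (F x) * (N ^ m / fact m)" for x
          using N[of x] by (simp add: norm_mult norm_divide norm_power mult_left_mono divide_right_mono power_mono)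
      qed (use F i in auto)
      then show ?thesis by simp
    qed
    show "summable (\<lambda>m. LINT x|M. norm (F x * q x ^ m / fact m))"
    proof (rule summable_comparison_test')
      show "summable (\<lambda>m. (LINT x|M. cmod (F x)) * (N ^ m / fact m))"
        using summable_mult[OF summable_exp[of N], of "LINT x|M. cmod (F x)"] by (simp add: divide_inverse mult_ac)
      show "norm (LINT x|M. norm (F x * q x ^ m / fact m)) \<le> (LINT x|M. cmod (F x)) * (N ^ m / fact m)" if "m \<ge> 0" for m
        using bnd[of m] by (simp add: integral_nonneg_AE)
    qed
  qed
  then show ?thesis using ex by (simp add: sums_iff)
qed

lemma integral_product_swap_bounded:
  fixes f g :: "real \<Rightarrow> complex" and K :: "real \<Rightarrow> real \<Rightarrow> complex"
  assumes f: "integrable lborel f" and g: "integrable lborel g"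
    and [measurable]: "(\<lambda>(x, y). K x y) \<in> borel_measurable (lborel \<Otimes>\<^sub>M lborel)"
    and B: "\<And>x y. cmod (K x y) \<le> B"
  shows "(LINT x|lborel. f x * (LINT y|lborel. g y * K x y)) = (LINT y|lborel. g y * (LINT x|lborel. f x * K x y))"
proof -
  have [measurable]: "f \<in> borel_measurable lborel" "g \<in> borel_measurable lborel" using f g by auto
  have iy: "integrable lborel (\<lambda>y. f x * (g y * K x y))" for x
  proof (rule Bochner_Integration.integrable_bound[of _ "\<lambda>y. (cmod (f x) * B) * cmod (g y)"])
    have "cmod (f x) * (cmod (g y) * cmod (K x y)) \<le> cmod (f x) * (cmod (g y) * \<bar>B\<bar>)" for y
      using B[of x y] by (intro mult_left_mono) auto
    then show "AE y in lborel. norm (f x * (g y * K x y)) \<le> norm ((cmod (f x) * B) * cmod (g y))"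
      by (intro AE_I2) (simp add: norm_mult abs_mult mult_ac)
  qed (use g in auto)
  have "integrable (lborel \<Otimes>\<^sub>M lborel) (\<lambda>(x, y). f x * (g y * K x y))"
  proof (rule lborel_pair.Fubini_integrable)
    show "AE x in lborel. integrable lborel (\<lambda>y. case (x, y) of (x, y) \<Rightarrow> f x * (g y * K x y))"
      using iy by simp
    show "integrable lborel (\<lambda>x. LINT y|lborel. norm (case (x, y) of (x, y) \<Rightarrow> f x * (g y * K x y)))"
    proof (rule Bochner_Integration.integrable_bound[of _ "\<lambda>x. (B * (LINT y|lborel. cmod (g y))) * cmod (f x)"])
      show "AE x in lborel. norm (LINT y|lborel. norm (case (x, y) of (x, y) \<Rightarrow> f x * (g y * K x y)))
        \<le> norm ((B * (LINT y|lborel. cmod (g y))) * cmod (f x))"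
      proof (rule AE_I2)
        fix x
        have "(LINT y|lborel. norm (f x * (g y * K x y))) \<le> (LINT y|lborel. (B * cmod (f x)) * cmod (g y))"
        proof (rule integral_mono)
          have "cmod (f x) * (cmod (g y) * cmod (K x y)) \<le> cmod (f x) * (cmod (g y) * B)" for y
            using B[of x y] by (intro mult_left_mono) auto
          then show "norm (f x * (g y * K x y)) \<le> (B * cmod (f x)) * cmod (g y)" for y
            by (simp add: norm_mult mult_ac)
        qed (use g integrable_norm[OF iy] in auto)
        then show "norm (LINT y|lborel. norm (case (x, y) of (x, y) \<Rightarrow> f x * (g y * K x y)))
        \<le> norm ((B * (LINT y|lborel. cmod (g y))) * cmod (f x))"
          using order_trans[OF norm_ge_zero B[of x x]] by (simp add: mult_ac abs_mult integral_nonneg_AE)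
      qed
    qed (use f in auto)
  qed measurable
  from lborel_pair.Fubini_integral[OF this]
  have "(LINT y|lborel. LINT x|lborel. f x * (g y * K x y)) = (LINT x|lborel. LINT y|lborel. f x * (g y * K x y))"
    by simp
  moreover have "f x * (g y * K x y) = g y * (f x * K x y)" for x y by simp
  ultimately show ?thesis by (simp only: integral_mult_right_zero[symmetric])
qed

text \<open>Integration by parts gives the antiderivative a Si(ax) - (1 - cos(ax))/x on the positive
  half-line, with limits 0 and a pi/2. The integrand is nonnegative, so the improper integral is a
  Lebesgue integral; evenness doubles it.\<close>

lemma has_bochner_integral_one_minus_cos:
  "has_bochner_integral lborel (\<lambda>x::real. (1 - cos (a * x)) / x\<^sup>2) (pi * \<bar>a\<bar>)"
proof -
  have pos: "has_bochner_integral lborel (\<lambda>x::real. (1 - cos (a * x)) / x\<^sup>2) (pi * a)" if a: "a > 0" for a :: real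
  proof -
    let ?f = "\<lambda>x::real. (1 - cos (a * x)) / x\<^sup>2"
    let ?F = "\<lambda>x::real. a * Si (a * x) - (1 - cos (a * x)) / x"
    have A: "(?F \<longlongrightarrow> 0) (at_right 0)"
    proof -
      have "((\<lambda>x. (1 - cos (a * x)) / x) \<longlongrightarrow> 0) (at_right 0)"
        by real_asymp
      moreover have "((\<lambda>x. Si (a * x)) \<longlongrightarrow> Si (a * 0)) (at 0)"
        using isCont_o2[where f="\<lambda>x. a * x" and g=Si and a=0, OF _ isCont_Si]
        unfolding isCont_def by (simp add: tendsto_mult_right_zero)
      then have "((\<lambda>x. Si (a * x)) \<longlongrightarrow> 0) (at_right 0)"
        by (auto simp: Si_def zero_ereal_def[symmetric] intro: filterlim_mono[OF _ order_refl at_le])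
      ultimately show ?thesis using tendsto_diff[OF tendsto_mult[OF tendsto_const[of a]]] by fastforce
    qed
    have B: "(?F \<longlongrightarrow> a * (pi / 2)) at_top"
    proof -
      have "((\<lambda>x. (1 - cos (a * x)) / x) \<longlongrightarrow> 0) at_top"
        by real_asymp
      moreover have "((\<lambda>x. Si (a * x)) \<longlongrightarrow> pi / 2) at_top"
        using a by (intro filterlim_compose[OF Si_at_top] filterlim_tendsto_pos_mult_at_top[OF tendsto_const])
          (auto intro: filterlim_ident)
      ultimately show ?thesis using tendsto_diff[OF tendsto_mult[OF tendsto_const[of a]]] by fastforce
    qed
    have D: "DERIV ?F x :> ?f x" if "0 < x" for x
    proof -
      have "DERIV (\<lambda>x. Si (a * x)) x :> sinc (a * x) * a"
        by (rule DERIV_chain2[OF DERIV_Si]) (auto intro!: derivative_eq_intros)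
      then show ?thesis
        using that a by (auto intro!: derivative_eq_intros simp: field_simps power2_eq_square)
    qed
    have "set_integrable lborel (einterval 0 \<infinity>) ?f" "(LBINT x=0..\<infinity>. ?f x) = a * (pi / 2) - 0"
      by (rule interval_integral_FTC_nonneg[where F = ?F];
          use A B D in \<open>auto simp: ereal_tendsto_simps1 zero_ereal_def intro!: continuous_intros AE_I2\<close>)+
    then have p: "has_bochner_integral lborel (\<lambda>x. indicator {0<..} x * ?f x) (a * pi / 2)"
      by (simp add: has_bochner_integral_iff interval_lebesgue_integral_def set_integrable_def
          set_lebesgue_integral_def einterval_eq zero_ereal_def)
    then have m: "has_bochner_integral lborel (\<lambda>x. indicator {0<..} (-x) * ?f (-x)) (a * pi / 2)"
      using lborel_has_bochner_integral_real_affine_iff[of "-1" "\<lambda>x. indicator {0<..} x * ?f x" "a * pi / 2" 0] by simp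
    have "(\<lambda>x. indicator {0<..} x * ?f x + indicator {0<..} (-x) * ?f (-x)) = ?f"
    proof
      show "indicator {0<..} x * ?f x + indicator {0<..} (-x) * ?f (-x) = ?f x" for x
        by (cases x "0::real" rule: linorder_cases) auto
    qed
    then show ?thesis using has_bochner_integral_add[OF p m] by (simp only:) (simp add: mult.commute)
  qed
  show ?thesis
  proof (cases a "0::real" rule: linorder_cases)
    case less
    then show ?thesis using pos[of "-a"] by simp
  qed (use pos[of a] in \<open>simp_all add: has_bochner_integral_zero\<close>)
qed

text \<open>\<open>fejer t 0 = 0\<close> because of division by zero; the point \<open>0\<close> is a null set.\<close>

definition fejer :: "real \<Rightarrow> real \<Rightarrow> complex" where
  "fejer t \<xi> = of_real ((1 - cos (t * \<xi>)) / (pi * \<xi>\<^sup>2))"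

definition tent :: "real \<Rightarrow> real \<Rightarrow> complex" where
  "tent t x = of_real (max 0 (t - \<bar>x\<bar>))"

lemma fejer_integrable: "integrable lborel (fejer t)"
proof -
  have "integrable lborel (\<lambda>\<xi>. complex_of_real ((1 - cos (t * \<xi>)) / \<xi>\<^sup>2 / pi))"
    using has_bochner_integral_one_minus_cos[of t]
    by (intro integrable_of_real integrable_divide) (auto simp: has_bochner_integral_iff)
  then show ?thesis by (simp add: fejer_def[abs_def] field_simps)
qed

text \<open>The product cos(x\<xi>)(1 - cos(t\<xi>)) is a combination of the functions 1 -
  cos(a\<xi>) with a = x + t, x - t and x, so the real part becomes (|x+t| + |x-t| - 2|x|)/2, which
  is the tent. The imaginary part is odd.\<close>

lemma fejer_transform:
  assumes "t \<ge> 0"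
  shows "(LINT \<xi>|lborel. fejer t \<xi> * exp (\<i> * of_real (\<xi> * x))) = tent t x"
proof -
  have m: "fejer t \<xi> * exp (\<i> * of_real (\<xi> * x)) =
     complex_of_real (((1 - cos ((x + t) * \<xi>)) / \<xi>\<^sup>2 + (1 - cos ((x - t) * \<xi>)) / \<xi>\<^sup>2 - 2 * ((1 - cos (x * \<xi>)) / \<xi>\<^sup>2)) / (2 * pi)) +
     \<i> * of_real ((1 - cos (t * \<xi>)) / (pi * \<xi>\<^sup>2) * sin (x * \<xi>))" for \<xi>
    by (cases "\<xi> = 0") (auto simp: complex_eq_iff fejer_def Re_exp Im_exp cos_add cos_diff field_simps)
  have "has_bochner_integral lborel (\<lambda>\<xi>. complex_of_real (((1 - cos ((x + t) * \<xi>)) / \<xi>\<^sup>2 + (1 - cos ((x - t) * \<xi>)) / \<xi>\<^sup>2 - 2 * ((1 - cos (x * \<xi>)) / \<xi>\<^sup>2)) / (2 * pi)))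
     (complex_of_real ((pi * \<bar>x + t\<bar> + pi * \<bar>x - t\<bar> - 2 * (pi * \<bar>x\<bar>)) / (2 * pi)))"
    by (intro has_bochner_integral_of_real has_bochner_integral_divide_zero has_bochner_integral_diff has_bochner_integral_add
        has_bochner_integral_mult_right has_bochner_integral_one_minus_cos)
  moreover have "(pi * \<bar>x + t\<bar> + pi * \<bar>x - t\<bar> - 2 * (pi * \<bar>x\<bar>)) / (2 * pi) = max 0 (t - \<bar>x\<bar>)"
    using assms by (auto simp: field_simps abs_if max_def)
  ultimately have 1: "has_bochner_integral lborel (\<lambda>\<xi>. complex_of_real (((1 - cos ((x + t) * \<xi>)) / \<xi>\<^sup>2 + (1 - cos ((x - t) * \<xi>)) / \<xi>\<^sup>2 - 2 * ((1 - cos (x * \<xi>)) / \<xi>\<^sup>2)) / (2 * pi)))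
     (tent t x)" by (simp add: tent_def)
  let ?s = "\<lambda>\<xi>. \<i> * complex_of_real ((1 - cos (t * \<xi>)) / (pi * \<xi>\<^sup>2) * sin (x * \<xi>))"
  have "(LINT \<xi>|lborel. ?s \<xi>) = (LINT \<xi>|lborel. ?s (- \<xi>))"
    using lborel_integral_real_affine[of "-1" ?s 0] by simp
  then have s0: "(LINT \<xi>|lborel. ?s \<xi>) = 0" by (simp)
  have "integrable lborel ?s"
  proof (rule Bochner_Integration.integrable_bound[OF fejer_integrable[of t]])
    have "\<bar>(1 - cos (t * \<xi>)) / (pi * \<xi>\<^sup>2) * sin (x * \<xi>)\<bar> \<le> \<bar>(1 - cos (t * \<xi>)) / (pi * \<xi>\<^sup>2)\<bar> * 1" for \<xi>
      unfolding abs_mult by (intro mult_left_mono) auto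
    then show "AE \<xi> in lborel. norm (?s \<xi>) \<le> norm (fejer t \<xi>)"
      by (intro AE_I2) (simp only: fejer_def norm_mult norm_ii norm_of_real, simp)
  qed measurable
  then have 2: "has_bochner_integral lborel ?s 0" using s0 by (simp add: has_bochner_integral_iff)
  show ?thesis unfolding m using has_bochner_integral_add[OF 1 2] by (simp add: has_bochner_integral_iff)
qed

section \<open>Convolution exponentials and their discretization\<close>

locale hermitian_cutoff =
  fixes R M :: real and l :: "real \<Rightarrow> complex"
  assumes R_pos: "R > 0"
    and l_cont: "continuous_on UNIV l"
    and l_herm: "\<And>x. l (- x) = cnj (l x)"
    and l_supp: "\<And>x. R \<le> \<bar>x\<bar> \<Longrightarrow> l x = 0"
    and l_bound: "\<And>x. cmod (l x) \<le> M"
begin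

text \<open>The 2n + 1 nodes of weight \<open>R / n\<close> have total mass at most
  \<open>3 * R\<close>, and the interval has length \<open>2 * R\<close>. Thus one constant bounds
  both convolution with \<open>l\<close> and its Riemann sum analogue.\<close>

abbreviation N :: real where "N \<equiv> 3 * R * M"

lemma M_nonneg: "0 \<le> M"
  using order_trans[OF norm_ge_zero l_bound[of 0]] .

lemma N_nonneg: "0 \<le> N"
  using M_nonneg R_pos by simp

lemma N1_pos: "0 < N + 1"
  using N_nonneg by (rule add_nonneg_pos) simp

lemma l_measurable [measurable]: "l \<in> borel_measurable borel"
  using l_cont by (rule borel_measurable_continuous_onI)

lemma
  fixes f :: "real \<Rightarrow> complex"
  assumes [measurable]: "f \<in> borel_measurable borel" and f: "\<And>y. cmod (f y) \<le> B"
  shows l_mult_integrable: "integrable lborel (\<lambda>y. l y * f y)"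
    and l_mult_integral_bound: "cmod (LINT y|lborel. l y * f y) \<le> N * B"
proof -
  have B: "0 \<le> B" using order_trans[OF norm_ge_zero f[of 0]] .
  have b: "cmod (l y * f y) \<le> indicator {-R..R} y * (M * B)" for y
  proof (cases "\<bar>y\<bar> \<le> R")
    case True
    then show ?thesis using mult_mono[OF l_bound f M_nonneg norm_ge_zero, of y y]
      by (simp add: norm_mult abs_le_iff)
  qed (use l_supp[of y] B M_nonneg in simp)
  have i: "integrable lborel (\<lambda>y. indicator {-R..R} y * (M * B))"
    using R_pos by (intro integrable_mult_left) auto
  show int: "integrable lborel (\<lambda>y. l y * f y)"
    by (rule Bochner_Integration.integrable_bound[OF i])
      (use b in \<open>auto intro!: AE_I2 intro: order_trans[OF _ abs_ge_self]\<close>)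
  have "cmod (LINT y|lborel. l y * f y) \<le> (LINT y|lborel. indicator {-R..R} y * (M * B))"
    by (rule Bochner_Integration.integral_norm_bound_integral[OF int i]) (use b in auto)
  also have "\<dots> = 2 * R * M * B" using R_pos by simp
  also have "\<dots> \<le> N * B" using R_pos M_nonneg B by (intro mult_right_mono) auto
  finally show "cmod (LINT y|lborel. l y * f y) \<le> N * B" .
qed

lemma l_integrable: "integrable lborel l"
  using l_mult_integrable[of "\<lambda>_. 1" 1] by simp

lemma l_ucont: "uniformly_continuous_on UNIV l"
proof -
  \<comment> \<open>The margin of 1 ensures that two points at distance below 1 either both lie in
    the enlarged interval or both lie where \<open>l\<close> vanishes.\<close>
  have u: "uniformly_continuous_on {-R-1..R+1} l"
    using l_cont by (intro compact_uniformly_continuous) (auto intro: continuous_on_subset)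
  show ?thesis unfolding uniformly_continuous_on_def
  proof (intro allI impI)
    fix e :: real assume "e > 0"
    then obtain d where d: "d > 0" "\<And>x y. x \<in> {-R-1..R+1} \<Longrightarrow> y \<in> {-R-1..R+1} \<Longrightarrow> dist y x < d \<Longrightarrow> dist (l y) (l x) < e"
      using u unfolding uniformly_continuous_on_def by metis
    have "dist (l y) (l x) < e" if "dist y x < min d 1" for x y
    proof (cases "x \<in> {-R-1..R+1} \<and> y \<in> {-R-1..R+1}")
      case False
      then have "l x = 0" "l y = 0" using that l_supp[of x] l_supp[of y] by (auto simp: dist_real_def abs_if split: if_splits)
      then show ?thesis using \<open>e > 0\<close> by simp
    qed (use d that in auto)
    then show "\<exists>d>0. \<forall>x\<in>UNIV. \<forall>y\<in>UNIV. dist y x < d \<longrightarrow> dist (l y) (l x) < e"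
      using d(1) by (intro exI[of _ "min d 1"]) auto
  qed
qed

text \<open>\<open>conv_pow m\<close> is the \<open>(m + 1)\<close>-fold convolution power of \<open>l\<close>, and \<open>mesh_pow n m\<close> is its Riemann sum
  analogue. Both are functions on the whole line, so that they can be compared uniformly; only
  the values of \<open>mesh_pow n m\<close> on the grid are related to \<open>\<mu>\<^sub>n\<close>.\<close>

primrec conv_pow :: "nat \<Rightarrow> real \<Rightarrow> complex" where
  "conv_pow 0 = l"
| "conv_pow (Suc m) = (\<lambda>x. LINT y|lborel. l y * conv_pow m (x - y))"

primrec mesh_pow :: "nat \<Rightarrow> nat \<Rightarrow> real \<Rightarrow> complex" where
  "mesh_pow n 0 = l"
| "mesh_pow n (Suc m) = (\<lambda>x. \<Sum>j\<in>{- int n..int n}.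
      of_real (R / real n) * l (of_int j * (R / real n)) * mesh_pow n m (x - of_int j * (R / real n)))"

text \<open>The two claims are proved together because bounding the next convolution needs
  measurability of the present one, which comes from its continuity, while splitting the difference
  of two translates needs the bound for integrability.\<close>

lemma conv_pow_props:
  "uniformly_continuous_on UNIV (conv_pow m) \<and> (\<forall>x. cmod (conv_pow m x) \<le> M * N ^ m)"
proof (induction m)
  case 0
  then show ?case using l_ucont l_bound by simp
next
  case (Suc m)
  then have c: "uniformly_continuous_on UNIV (conv_pow m)" and b: "\<And>x. cmod (conv_pow m x) \<le> M * N ^ m" by auto
  have [measurable]: "conv_pow m \<in> borel_measurable borel"
    using c by (intro borel_measurable_continuous_onI uniformly_continuous_imp_continuous)
  have "cmod (conv_pow (Suc m) x) \<le> M * N ^ Suc m" for x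
    using l_mult_integral_bound[of "\<lambda>y. conv_pow m (x - y)" "M * N ^ m"] b by (simp add: mult_ac)
  moreover have "uniformly_continuous_on UNIV (conv_pow (Suc m))"
    unfolding uniformly_continuous_on_def
  proof (intro allI impI)
    fix e :: real assume "e > 0"
    then have e: "e / (N + 1) > 0" using N1_pos by (rule divide_pos_pos)
    then obtain d where d: "d > 0" "\<And>x y. dist y x < d \<Longrightarrow> dist (conv_pow m y) (conv_pow m x) < e / (N + 1)"
      using c unfolding uniformly_continuous_on_def by (metis UNIV_I)
    have "dist (conv_pow (Suc m) y) (conv_pow (Suc m) x) < e" if "dist y x < d" for x y
    proof -
      have "conv_pow (Suc m) y - conv_pow (Suc m) x = (LINT z|lborel. l z * (conv_pow m (y - z) - conv_pow m (x - z)))"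
        by (simp add: right_diff_distrib Bochner_Integration.integral_diff l_mult_integrable[where B = "M * N ^ m"] b)
      also have "cmod \<dots> \<le> N * (e / (N + 1))"
      proof (rule l_mult_integral_bound)
        show "cmod (conv_pow m (y - z) - conv_pow m (x - z)) \<le> e / (N + 1)" for z
          using d(2)[of "y - z" "x - z"] that by (simp add: dist_norm)
      qed measurable
      also have "\<dots> < e" using N1_pos \<open>e > 0\<close> by (simp add: pos_divide_less_eq times_divide_eq_right ac_simps)
      finally show ?thesis by (simp add: dist_norm)
    qed
    then show "\<exists>d>0. \<forall>x\<in>UNIV. \<forall>y\<in>UNIV. dist y x < d \<longrightarrow> dist (conv_pow (Suc m) y) (conv_pow (Suc m) x) < e"
      using d(1) by blast
  qed
  ultimately show ?case by blast
qed

lemma conv_pow_ucont: "uniformly_continuous_on UNIV (conv_pow m)"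
  and conv_pow_bound: "cmod (conv_pow m x) \<le> M * N ^ m"
  using conv_pow_props by auto

lemma conv_pow_cont: "continuous_on UNIV (conv_pow m)"
  using conv_pow_ucont by (rule uniformly_continuous_imp_continuous)

lemma conv_pow_measurable [measurable]: "conv_pow m \<in> borel_measurable borel"
  using conv_pow_cont by (rule borel_measurable_continuous_onI)

lemma mesh_sum_bound:
  assumes n: "n \<ge> 1" and f: "\<And>j. cmod (f j) \<le> B"
  shows "cmod (\<Sum>j\<in>{- int n..int n}. of_real (R / real n) * l (of_int j * (R / real n)) * f j) \<le> N * B"
proof -
  have B: "0 \<le> B" using order_trans[OF norm_ge_zero f[of 0]] .
  have "cmod (\<Sum>j\<in>{- int n..int n}. of_real (R / real n) * l (of_int j * (R / real n)) * f j)
     \<le> (\<Sum>j\<in>{- int n..int n}. R / real n * M * B)"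
  proof (rule sum_norm_le)
    fix j
    show "cmod (of_real (R / real n) * l (of_int j * (R / real n)) * f j) \<le> R / real n * M * B"
      unfolding norm_mult norm_of_real using R_pos B M_nonneg
      by (intro mult_mono f l_bound) auto
  qed
  also have "\<dots> = real (2 * n + 1) * (R / real n) * (M * B)" by (simp add: nat_add_distrib)
  also have "\<dots> \<le> (3 * R) * (M * B)"
    using n R_pos M_nonneg B by (intro mult_right_mono) (auto simp: field_simps)
  finally show ?thesis by (simp add: mult_ac)
qed

lemma mesh_pow_bound: "n \<ge> 1 \<Longrightarrow> cmod (mesh_pow n m x) \<le> M * N ^ m"
proof (induction m arbitrary: x)
  case (Suc m)
  then show ?case using mesh_sum_bound[of n "\<lambda>j. mesh_pow n m (x - of_int j * (R / real n))" "M * N ^ m"]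
    by (simp add: mult_ac)
qed (use l_bound in simp)

text \<open>After translation to [0, 2R] the node with index 2n falls exactly on the right end, so
  \<open>riemann_sum_error\<close> applies with no incomplete cell.\<close>

lemma riemann_sum_symmetric:
  fixes f :: "real \<Rightarrow> complex"
  assumes n: "n \<ge> 1" and f: "continuous_on UNIV f" "\<And>y. R \<le> \<bar>y\<bar> \<Longrightarrow> f y = 0"
    and B: "\<And>y. cmod (f y) \<le> B" and e: "\<And>u v. \<bar>u - v\<bar> \<le> R / real n \<Longrightarrow> cmod (f u - f v) \<le> e"
  shows "cmod ((LINT y|lborel. f y) - (\<Sum>j\<in>{- int n..int n}. of_real (R / real n) * f (of_int j * (R / real n))))
    \<le> 2 * R * e + R / real n * B"
proof -
  have "(LINT y|lborel. f y) = (LINT y:{-R..R}|lborel. f y)"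
    unfolding set_lebesgue_integral_def by (rule Bochner_Integration.integral_cong) (use f(2) in \<open>auto split: split_indicator\<close>)
  also have "\<dots> = integral {-R..R} f"
    by (intro set_borel_integral_eq_integral borel_integrable_atLeastAtMost' continuous_on_subset[OF f(1)]) auto
  also have "\<dots> = integral {0..2*R} (\<lambda>u. f (u - R))"
    using integral_shift_Icc_real[of 0 "2 * R" f "- R"] by (simp add: comp_def)
  finally have 1: "(LINT y|lborel. f y) = integral {0..2*R} (\<lambda>u. f (u - R))" .
  have 2: "(\<Sum>j\<in>{- int n..int n}. of_real (R / real n) * f (of_int j * (R / real n)))
    = (\<Sum>i\<le>2*n. of_real (R / real n) * f (real i * (R / real n) - R))"
    using n by (intro sum.reindex_bij_witness[of _ "\<lambda>i. int i - int n" "\<lambda>j. nat (j + int n)"])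
      (auto simp: field_simps)
  have "cmod (integral {0..2*R} (\<lambda>u. f (u - R)) - (\<Sum>i\<le>2*n. of_real (R / real n) * f (real i * (R / real n) - R)))
     \<le> 2 * R * e + R / real n * B"
    using n R_pos by (intro riemann_sum_error)
      (auto intro!: B e continuous_on_compose2[OF f(1)] continuous_intros simp: field_simps)
  then show ?thesis using 1 2 by simp
qed

lemma mesh_tendsto_0: "(\<lambda>n. R / real n) \<longlonglongrightarrow> 0"
  by (rule lim_const_over_n)

text \<open>One induction step adds a quadrature error for \<open>l y * conv_pow m (x - y)\<close>
  and a Riemann sum of the previous error, which has mass at most \<open>N\<close>. Uniformity in
  \<open>x\<close> holds because the modulus of continuity of that integrand in \<open>y\<close>
  does not depend on \<open>x\<close>.\<close>

lemma mesh_pow_limit: "uniform_limit UNIV (\<lambda>n. mesh_pow n m) (conv_pow m) sequentially"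
proof (induction m)
  case 0
  then show ?case by (simp add: uniform_limit_iff)
next
  case (Suc m)
  let ?B = "M * N ^ m"
  have B: "0 \<le> ?B" using M_nonneg R_pos by simp
  show ?case unfolding uniform_limit_iff
  proof (intro allI impI)
    fix e :: real assume e: "e > 0"
    \<comment> \<open>The error is split into thirds: \<open>e1\<close> for the inherited error,
      \<open>e2\<close> for the oscillation of the integrand, and the last third for the surplus
      node of the quadrature.\<close>
    define e1 where "e1 = e / (3 * (N + 1))"
    define e2 where "e2 = e / (6 * R * (?B + M + 1))"
    have e1: "e1 > 0" unfolding e1_def using e N1_pos by (intro divide_pos_pos mult_pos_pos) auto
    have e2: "e2 > 0" unfolding e2_def using e R_pos B M_nonneg
      by (intro divide_pos_pos mult_pos_pos; linarith)
    obtain d1 where d1: "d1 > 0" "\<And>x y. dist y x < d1 \<Longrightarrow> dist (l y) (l x) < e2"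
      using l_ucont e2 unfolding uniformly_continuous_on_def by (metis UNIV_I)
    obtain d2 where d2: "d2 > 0" "\<And>x y. dist y x < d2 \<Longrightarrow> dist (conv_pow m y) (conv_pow m x) < e2"
      using conv_pow_ucont[of m] e2 unfolding uniformly_continuous_on_def by (metis UNIV_I)
    have m1: "\<forall>\<^sub>F n in sequentially. R / real n < min d1 d2"
      using order_tendstoD(2)[OF mesh_tendsto_0, of "min d1 d2"] d1 d2 by simp
    have m2: "\<forall>\<^sub>F n in sequentially. R / real n * (M * ?B) < e / 3"
      using order_tendstoD(2)[OF tendsto_mult_left_zero[OF mesh_tendsto_0, of "M * ?B"], of "e / 3"] e by simp
    have m3: "\<forall>\<^sub>F n in sequentially. \<forall>x. dist (mesh_pow n m x) (conv_pow m x) < e1"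
      using Suc e1 unfolding uniform_limit_iff by simp
    show "\<forall>\<^sub>F n in sequentially. \<forall>x\<in>UNIV. dist (mesh_pow n (Suc m) x) (conv_pow (Suc m) x) < e"
      using m1 m2 m3 eventually_ge_at_top[of 1]
    proof eventually_elim
      case (elim n)
      show ?case
      proof
        fix x :: real
        let ?h = "R / real n"
        let ?f = "\<lambda>y. l y * conv_pow m (x - y)"
        have 1: "cmod ((LINT y|lborel. ?f y) - (\<Sum>j\<in>{- int n..int n}. of_real ?h * ?f (of_int j * ?h)))
          \<le> 2 * R * (e2 * (?B + M)) + ?h * (M * ?B)"
        proof (rule riemann_sum_symmetric)
          show "continuous_on UNIV ?f"
            by (intro continuous_intros l_cont continuous_on_compose2[OF conv_pow_cont]) auto
          show "cmod (?f y) \<le> M * ?B" for y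
            unfolding norm_mult using M_nonneg by (intro mult_mono l_bound conv_pow_bound) auto
          fix u v assume uv: "\<bar>u - v\<bar> \<le> ?h"
          have "?f u - ?f v = (l u - l v) * conv_pow m (x - u) + l v * (conv_pow m (x - u) - conv_pow m (x - v))"
            by (simp add: algebra_simps)
          also have "cmod \<dots> \<le> e2 * ?B + M * e2"
          proof (intro norm_triangle_mono; unfold norm_mult; intro mult_mono l_bound conv_pow_bound)
            show "cmod (l u - l v) \<le> e2"
              using d1(2)[of u v] uv elim(1) by (simp add: dist_norm)
            show "cmod (conv_pow m (x - u) - conv_pow m (x - v)) \<le> e2"
              using d2(2)[of "x - u" "x - v"] uv elim(1) by (simp add: dist_norm abs_minus_commute)
          qed (use e2 M_nonneg in auto)
          finally show "cmod (?f u - ?f v) \<le> e2 * (?B + M)" by (simp add: algebra_simps)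
        qed (use elim l_supp in auto)
        have 2: "cmod (\<Sum>j\<in>{- int n..int n}. of_real ?h * l (of_int j * ?h) *
             (mesh_pow n m (x - of_int j * ?h) - conv_pow m (x - of_int j * ?h))) \<le> N * e1"
          using elim(3,4) by (intro mesh_sum_bound) (auto simp: dist_norm intro: less_imp_le)
        have "dist (mesh_pow n (Suc m) x) (conv_pow (Suc m) x) = cmod (conv_pow (Suc m) x - mesh_pow n (Suc m) x)"
          by (simp add: dist_norm norm_minus_commute)
        also have "conv_pow (Suc m) x - mesh_pow n (Suc m) x =
           ((LINT y|lborel. ?f y) - (\<Sum>j\<in>{- int n..int n}. of_real ?h * ?f (of_int j * ?h))) -
           (\<Sum>j\<in>{- int n..int n}. of_real ?h * l (of_int j * ?h) *
             (mesh_pow n m (x - of_int j * ?h) - conv_pow m (x - of_int j * ?h)))"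
          by (simp add: right_diff_distrib sum_subtractf mult_ac)
        also have "cmod \<dots> \<le> (2 * R * (e2 * (?B + M)) + ?h * (M * ?B)) + N * e1"
          by (rule order_trans[OF norm_triangle_ineq4 add_mono[OF 1 2]])
        also have "\<dots> < e / 3 + e / 3 + e / 3"
        proof -
          have "2 * R * (e2 * (?B + M)) = e / 3 * ((?B + M) / (?B + M + 1))"
            using R_pos B M_nonneg by (simp add: e2_def divide_simps)
          also have "\<dots> \<le> e / 3 * 1"
            using e B M_nonneg by (intro mult_left_mono) (auto simp: divide_le_eq_1)
          finally have a: "2 * R * (e2 * (?B + M)) \<le> e / 3" by simp
          have b: "N * e1 \<le> e / 3" unfolding e1_def times_divide_eq_right using N1_pos e by (subst pos_divide_le_eq) auto
          show ?thesis using a b elim(2) by linarith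
        qed
        finally show "dist (mesh_pow n (Suc m) x) (conv_pow (Suc m) x) < e" by simp
      qed
    qed
  qed
qed

text \<open>\<open>conv_exp\<close> is the complex conjugate of the accelerant, \<open>h mesh_exp n\<close> gives the normalized moments, up to the term \<open>\<delta>\<^sub>k\<^sub>0\<close>, of \<open>\<mu>\<^sub>n\<close>.\<close>

definition conv_exp :: "real \<Rightarrow> complex" where
  "conv_exp x = (\<Sum>m. conv_pow m x / fact (Suc m))"

definition mesh_exp :: "nat \<Rightarrow> real \<Rightarrow> complex" where
  "mesh_exp n x = (\<Sum>m. mesh_pow n m x / fact (Suc m))"

text \<open>Common bound of \<open>conv_exp\<close> and \<open>mesh_exp\<close>, obtained from M N^m
  / (m+1)! \<le> M N^m / m!.\<close>

definition C :: real where "C = M * exp N"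

lemma term_bound: "cmod z \<le> M * N ^ m \<Longrightarrow> cmod (z / fact (Suc m)) \<le> M * (N ^ m / fact m)"
proof -
  assume z: "cmod z \<le> M * N ^ m"
  have "cmod (z / fact (Suc m)) = cmod z / fact (Suc m)" by (simp only: norm_divide norm_fact)
  also have "\<dots> \<le> (M * N ^ m) / fact m"
    using z M_nonneg R_pos by (intro frac_le fact_mono) auto
  finally show ?thesis by simp
qed

lemma term_sums: "(\<lambda>m. M * (N ^ m / fact m)) sums C"
  using sums_mult[OF exp_converges[of N], of M] by (simp add: C_def divide_inverse mult_ac)

lemma conv_exp_sums: "(\<lambda>m. conv_pow m x / fact (Suc m)) sums conv_exp x"
  unfolding conv_exp_def
  by (intro summable_sums summable_comparison_test'[OF sums_summable[OF term_sums]] term_bound conv_pow_bound)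

lemma mesh_exp_sums: "n \<ge> 1 \<Longrightarrow> (\<lambda>m. mesh_pow n m x / fact (Suc m)) sums mesh_exp n x"
  unfolding mesh_exp_def
  by (intro summable_sums summable_comparison_test'[OF sums_summable[OF term_sums]] term_bound mesh_pow_bound)

lemma conv_exp_bound: "cmod (conv_exp x) \<le> C"
  unfolding conv_exp_def sums_unique[OF term_sums]
  by (intro norm_suminf_le sums_summable[OF term_sums] term_bound conv_pow_bound)

lemma mesh_exp_bound: "n \<ge> 1 \<Longrightarrow> cmod (mesh_exp n x) \<le> C"
  unfolding mesh_exp_def sums_unique[OF term_sums]
  by (intro norm_suminf_le sums_summable[OF term_sums] term_bound mesh_pow_bound)

lemma C_nonneg: "0 \<le> C"
  by (simp add: C_def M_nonneg)

lemma conv_exp_cont: "continuous_on UNIV conv_exp"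
proof (rule uniform_limit_theorem)
  show "uniform_limit UNIV (\<lambda>k x. \<Sum>m<k. conv_pow m x / fact (Suc m)) conv_exp sequentially"
    unfolding conv_exp_def[abs_def]
    by (rule Weierstrass_m_test[OF _ sums_summable[OF term_sums]]) (intro term_bound conv_pow_bound)
  show "\<forall>\<^sub>F k in sequentially. continuous_on UNIV (\<lambda>x. \<Sum>m<k. conv_pow m x / fact (Suc m))"
    by (intro always_eventually allI continuous_intros conv_pow_cont) (auto simp del: fact_Suc)
qed simp

lemma conv_exp_measurable [measurable]: "conv_exp \<in> borel_measurable borel"
  using conv_exp_cont by (rule borel_measurable_continuous_onI)

text \<open>Failure of uniformity would produce bad points for infinitely many \<open>n\<close>.
  Along any sequence of points, however, the uniform limits of the separate terms and the summable
  majorant allow Tannery's theorem to exchange limit and sum.\<close>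

lemma mesh_exp_limit: "uniform_limit UNIV mesh_exp conv_exp sequentially"
proof (rule ccontr)
  assume "\<not> uniform_limit UNIV mesh_exp conv_exp sequentially"
  then obtain e where e: "e > 0" and f: "\<exists>\<^sub>F n in sequentially. \<exists>x. \<not> dist (mesh_exp n x) (conv_exp x) < e"
    unfolding uniform_limit_iff by (auto simp: not_eventually)
  \<comment> \<open>The point \<open>x n\<close> is bad whenever some point is bad for
    \<open>n\<close>; for the other \<open>n\<close> it is arbitrary. Closeness at
    \<open>x n\<close> therefore means closeness everywhere.\<close>
  define x where "x n = (SOME x. \<not> dist (mesh_exp n x) (conv_exp x) < e)" for n
  let ?a = "\<lambda>m n. (mesh_pow n m (x n) - conv_pow m (x n)) / fact (Suc m)"
  have "(\<lambda>n. \<Sum>m. ?a m n) \<longlonglongrightarrow> (\<Sum>m. 0)"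
  proof (intro conjunct2[OF conjunct2[OF tannerys_theorem]])
    fix m
    have "(\<lambda>n. mesh_pow n m (x n) - conv_pow m (x n)) \<longlonglongrightarrow> 0"
      by (rule tendstoI, drule uniform_limitD[OF mesh_pow_limit[of m]]) (auto simp: dist_norm elim: eventually_mono)
    then show "(\<lambda>n. ?a m n) \<longlonglongrightarrow> 0"
      using tendsto_divide_zero by blast
  next
    have "cmod (?a m n) \<le> 2 * (M * (N ^ m / fact m))" if "n \<ge> 1" for m n
    proof -
      have "cmod (?a m n) \<le> cmod (mesh_pow n m (x n) / fact (Suc m)) + cmod (conv_pow m (x n) / fact (Suc m))"
        unfolding diff_divide_distrib by (rule norm_triangle_ineq4)
      also have "\<dots> \<le> M * (N ^ m / fact m) + M * (N ^ m / fact m)"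
        using that by (intro add_mono term_bound mesh_pow_bound conv_pow_bound)
      finally show ?thesis by simp
    qed
    then show "\<forall>\<^sub>F (m, n) in sequentially \<times>\<^sub>F sequentially. cmod (?a m n) \<le> 2 * (M * (N ^ m / fact m))"
      unfolding eventually_prod_sequentially by auto
    show "summable (\<lambda>m. 2 * (M * (N ^ m / fact m)))"
      by (intro summable_mult sums_summable[OF term_sums])
  qed simp
  then have t: "(\<lambda>n. \<Sum>m. ?a m n) \<longlonglongrightarrow> 0" by simp
  have s: "(\<Sum>m. ?a m n) = mesh_exp n (x n) - conv_exp (x n)" if "n \<ge> 1" for n
    using sums_diff[OF mesh_exp_sums[OF that] conv_exp_sums, of "x n" "x n"] by (simp add: sums_iff diff_divide_distrib)
  have "\<forall>\<^sub>F n in sequentially. \<forall>y. dist (mesh_exp n y) (conv_exp y) < e"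
    using tendstoD[OF t e] eventually_ge_at_top[of 1]
  proof eventually_elim
    case (elim n)
    then have "dist (mesh_exp n (x n)) (conv_exp (x n)) < e" using s[of n] by (simp add: dist_norm)
    then show ?case unfolding x_def using someI[of "\<lambda>x. \<not> dist (mesh_exp n x) (conv_exp x) < e"] by blast
  qed
  then show False using f by (simp add: frequently_def)
qed

end

section \<open>Toeplitz matrices of the circle measure\<close>

text \<open>The restriction to one period and the normalization by 2 pi are built in, so that
  Fourier coefficients on the circle are plain Lebesgue integrals over the line and multiplication
  by z^j only lowers the index by j.\<close>

definition circle_char :: "int \<Rightarrow> real \<Rightarrow> complex" where
  "circle_char k \<theta> = of_real (indicator {0..<2*pi} \<theta> / (2 * pi)) * cis (- (of_int k * \<theta>))"

lemma cis_measurable [measurable]: "cis \<in> borel_measurable borel"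
  by (intro borel_measurable_continuous_onI continuous_intros)

lemma circle_char_measurable [measurable]: "circle_char k \<in> borel_measurable borel"
  unfolding circle_char_def[abs_def] by measurable

lemma circle_char_mult: "circle_char k \<theta> * cis \<theta> powi j = circle_char (k - j) \<theta>"
  by (simp add: circle_char_def cis_power_int cis_mult algebra_simps)

lemma circle_char_mult_cnj: "cnj (cis (real k * \<theta>)) * cis (real i * \<theta>) * circle_char 0 \<theta> = circle_char (int k - int i) \<theta>"
  by (simp add: circle_char_def cis_cnj cis_mult algebra_simps)

lemma circle_char_integrable: "integrable lborel (circle_char k)"
proof (rule Bochner_Integration.integrable_bound)
  show "integrable lborel (\<lambda>\<theta>. indicator {0..<2*pi} \<theta> / (2 * pi) :: real)" by auto
  show "AE \<theta> in lborel. norm (circle_char k \<theta>) \<le> norm (indicator {0..<2*pi} \<theta> / (2 * pi) :: real)"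
    by (intro AE_I2) (simp only: circle_char_def norm_mult norm_of_real norm_cis, simp)
qed measurable

lemma circle_char_integral: "(LINT \<theta>|lborel. circle_char k \<theta>) = (if k = 0 then 1 else 0)"
proof -
  let ?F = "\<lambda>\<theta>::real. if k = 0 then of_real \<theta> else cis (- (of_int k * \<theta>)) / (- \<i> * of_int k)"
  have "has_bochner_integral lborel (\<lambda>\<theta>. indicator {0..2*pi} \<theta> *\<^sub>R cis (- (of_int k * \<theta>))) (?F (2 * pi) - ?F 0)"
  proof (rule has_bochner_integral_FTC_Icc)
    fix \<theta> :: real
    show "(?F has_vector_derivative cis (- (of_int k * \<theta>))) (at \<theta> within {0..2*pi})"
    proof (cases "k = 0")
      case True
      then show ?thesis by (simp add: has_vector_derivative_def) (auto intro!: derivative_eq_intros simp: scaleR_conv_of_real)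
    next
      case False
      have "((\<lambda>\<theta>. cis (- (of_int k * \<theta>)) / (- \<i> * of_int k)) has_vector_derivative
         (- of_int k * (\<i> * cis (- (of_int k * \<theta>)))) / (- \<i> * of_int k)) (at \<theta> within {0..2*pi})"
        unfolding cis_conv_exp
        by (auto intro!: derivative_eq_intros has_vector_derivative_divide has_vector_derivative_real_field simp: field_simps)
      then show ?thesis using False by (simp add: field_simps)
    qed
  qed (auto intro!: continuous_intros)
  moreover have "?F (2 * pi) - ?F 0 = (if k = 0 then 2 * pi else 0)"
    using cis_multiple_2pi[of "- of_int k"] by (auto simp: mult_ac)
  ultimately have "(LINT \<theta>|lborel. indicator {0..2*pi} \<theta> *\<^sub>R cis (- (of_int k * \<theta>))) = (if k = 0 then 2 * pi else 0)"
    by (simp add: has_bochner_integral_iff)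
  moreover have "(LINT \<theta>|lborel. circle_char k \<theta>) = (LINT \<theta>|lborel. (indicator {0..2*pi} \<theta> *\<^sub>R cis (- (of_int k * \<theta>))) / of_real (2 * pi))"
  proof (rule integral_cong_AE)
    show "AE \<theta> in lborel. circle_char k \<theta> = (indicator {0..2*pi} \<theta> *\<^sub>R cis (- (of_int k * \<theta>))) / of_real (2 * pi)"
      using AE_lborel_singleton[of "2 * pi"]
      by eventually_elim (auto simp: circle_char_def split: split_indicator)
  qed measurable
  ultimately show ?thesis by (simp only: integral_divide_zero) simp
qed

section \<open>Moments of the circle measure and coercivity of their Toeplitz matrices\<close>

context hermitian_cutoff
begin

definition exponent :: "nat \<Rightarrow> real \<Rightarrow> complex" where
  "exponent n \<theta> = (\<Sum>j\<in>{- int n..int n}. of_real (R / real n) * l (of_int j * (R / real n)) * cis \<theta> powi j)"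

definition weight :: "nat \<Rightarrow> real \<Rightarrow> real" where
  "weight n \<theta> = Re (exp (exponent n \<theta>))"

definition moment :: "nat \<Rightarrow> int \<Rightarrow> complex" where
  "moment n k = (LINT \<theta>|lborel. circle_char k \<theta> * exp (exponent n \<theta>))"

lemma exponent_measurable [measurable]: "exponent n \<in> borel_measurable borel"
  unfolding exponent_def[abs_def] cis_power_int by measurable

lemma exponent_real: "exponent n \<theta> \<in> \<real>"
proof -
  have "cnj (exponent n \<theta>) = (\<Sum>j\<in>{- int n..int n}. of_real (R / real n) * l (of_int (- j) * (R / real n)) * cis \<theta> powi (- j))"
    unfolding exponent_def by (simp add: cis_power_int cis_cnj flip: l_herm)
  also have "\<dots> = exponent n \<theta>"
    unfolding exponent_def by (intro sum.reindex_bij_witness[of _ uminus uminus]) auto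
  finally show ?thesis by (simp add: Reals_cnj_iff)
qed

lemma exponent_bound: "n \<ge> 1 \<Longrightarrow> cmod (exponent n \<theta>) \<le> N"
  unfolding exponent_def using mesh_sum_bound[of n "\<lambda>j. cis \<theta> powi j" 1] by (simp add: cis_power_int)

lemma exp_exponent: "exp (exponent n \<theta>) = of_real (weight n \<theta>)"
proof -
  obtain r where "exponent n \<theta> = of_real r" using exponent_real[of n \<theta>] by (auto elim: Reals_cases)
  then show ?thesis by (simp add: weight_def flip: exp_of_real)
qed

lemma weight_bounds:
  assumes "n \<ge> 1"
  shows "exp (- N) \<le> weight n \<theta>" "weight n \<theta> \<le> exp N"
proof -
  obtain r where r: "exponent n \<theta> = of_real r" using exponent_real[of n \<theta>] by (auto elim: Reals_cases)
  then have "\<bar>r\<bar> \<le> N" using exponent_bound[OF assms, of \<theta>] by simp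
  then show "exp (- N) \<le> weight n \<theta>" "weight n \<theta> \<le> exp N" using r by (auto simp: weight_def Re_exp)
qed

lemma weight_measurable [measurable]: "weight n \<in> borel_measurable borel"
  unfolding weight_def[abs_def] by measurable

lemma circle_char_mult_integrable:
  assumes [measurable]: "g \<in> borel_measurable borel" and B: "\<And>\<theta>. cmod (g \<theta>) \<le> B"
  shows "integrable lborel (\<lambda>\<theta>. circle_char k \<theta> * g \<theta>)"
proof (rule Bochner_Integration.integrable_bound)
  show "integrable lborel (\<lambda>\<theta>. B * cmod (circle_char k \<theta>))" using circle_char_integrable by auto
  show "AE \<theta> in lborel. norm (circle_char k \<theta> * g \<theta>) \<le> norm (B * cmod (circle_char k \<theta>))"
  proof (rule AE_I2)
    fix \<theta>
    have "norm (circle_char k \<theta> * g \<theta>) \<le> B * cmod (circle_char k \<theta>)"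
      unfolding norm_mult by (subst mult.commute) (intro mult_right_mono B norm_ge_zero)
    then show "norm (circle_char k \<theta> * g \<theta>) \<le> norm (B * cmod (circle_char k \<theta>))" by simp
  qed
qed measurable

text \<open>Splitting off one factor \<open>exponent n \<theta>\<close> convolves the sequence of
  Fourier coefficients with h l(jh), which is the recursion of \<open>mesh_pow\<close>. Of the m + 1
  factors \<open>h\<close>, m are weights of the Riemann sums and one remains in front.\<close>

lemma exponent_power_moment:
  assumes n: "n \<ge> 1"
  shows "(LINT \<theta>|lborel. circle_char k \<theta> * exponent n \<theta> ^ Suc m) = of_real (R / real n) * mesh_pow n m (of_int k * (R / real n))"
proof (induction m arbitrary: k)
  let ?h = "R / real n"
  have expand: "circle_char k \<theta> * exponent n \<theta> ^ Suc m =
     (\<Sum>j\<in>{- int n..int n}. of_real ?h * l (of_int j * ?h) * (circle_char (k - j) \<theta> * exponent n \<theta> ^ m))" for k m \<theta>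
    unfolding power_Suc by (subst (1) exponent_def)
      (simp add: sum_distrib_left sum_distrib_right mult_ac flip: circle_char_mult)
  have i: "integrable lborel (\<lambda>\<theta>. circle_char k \<theta> * exponent n \<theta> ^ m)" for k m
    by (rule circle_char_mult_integrable[where B = "N ^ m"]) (auto simp: norm_power intro!: power_mono exponent_bound n)
  have e: "(LINT \<theta>|lborel. circle_char k \<theta> * exponent n \<theta> ^ Suc m) =
     (\<Sum>j\<in>{- int n..int n}. of_real ?h * l (of_int j * ?h) * (LINT \<theta>|lborel. circle_char (k - j) \<theta> * exponent n \<theta> ^ m))" for k m
    unfolding expand by (subst Bochner_Integration.integral_sum) (auto intro!: integrable_mult_right i)
  {
    case 0
    have "(LINT \<theta>|lborel. circle_char k \<theta> * exponent n \<theta> ^ Suc 0) = (\<Sum>j\<in>{- int n..int n}. if j = k then of_real ?h * l (of_int j * ?h) else 0)"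
      unfolding e by (rule sum.cong) (auto simp: circle_char_integral)
    also have "\<dots> = of_real ?h * l (of_int k * ?h)"
    proof (cases "k \<in> {- int n..int n}")
      \<comment> \<open>For \<open>k\<close> outside the range of summation the Fourier coefficient
        is 0, in agreement with \<open>l\<close>, which vanishes at kh.\<close>
      case False
      then have "real n \<le> \<bar>of_int k\<bar>" by auto
      then have "R \<le> \<bar>of_int k * ?h\<bar>" using n R_pos by (simp add: abs_mult field_simps)
      then show ?thesis using False l_supp by (subst sum.neutral) auto
    qed (simp add: sum.delta)
    finally show ?case by simp
  next
    case (Suc m)
    then show ?case unfolding e[of _ "Suc m"] by (simp add: sum_distrib_left algebra_simps diff_divide_distrib)
  }
qed

lemma moment_eq:
  assumes n: "n \<ge> 1"
  shows "moment n k = (if k = 0 then 1 else 0) + of_real (R / real n) * mesh_exp n (of_int k * (R / real n))"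
proof -
  let ?h = "R / real n"
  have "(\<lambda>m. (LINT \<theta>|lborel. circle_char k \<theta> * exponent n \<theta> ^ m) / fact m) sums moment n k"
    unfolding moment_def by (rule integral_exp_series[OF circle_char_integrable _ exponent_bound[OF n]]) measurable
  then have "(\<lambda>m. (LINT \<theta>|lborel. circle_char k \<theta> * exponent n \<theta> ^ Suc m) / fact (Suc m)) sums
     (moment n k - (if k = 0 then 1 else 0))"
    by (subst sums_Suc_iff) (simp add: circle_char_integral del: fact_Suc power_Suc)
  then have "(\<lambda>m. of_real ?h * (mesh_pow n m (of_int k * ?h) / fact (Suc m))) sums (moment n k - (if k = 0 then 1 else 0))"
    by (simp add: exponent_power_moment[OF n] del: fact_Suc power_Suc)
  from sums_unique2[OF this sums_mult[OF mesh_exp_sums[OF n]]] show ?thesis by (simp add: algebra_simps)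
qed

text \<open>The quadratic form is the integral of \<open>g\<close> times the squared modulus of the
  trigonometric polynomial with coefficients \<open>v\<close>. A general \<open>g\<close> is allowed
  in order to compare g = 1, which is Parseval, with the weight itself.\<close>

lemma toeplitz_form:
  fixes v :: "nat \<Rightarrow> complex" and g :: "real \<Rightarrow> complex"
  assumes [measurable]: "g \<in> borel_measurable borel" and B: "\<And>\<theta>. cmod (g \<theta>) \<le> B"
  shows "(\<Sum>k<J. \<Sum>i<J. cnj (v k) * v i * (LINT \<theta>|lborel. circle_char (int k - int i) \<theta> * g \<theta>))
    = (LINT \<theta>|lborel. circle_char 0 \<theta> * g \<theta> * of_real ((cmod (\<Sum>i<J. v i * cis (real i * \<theta>)))\<^sup>2))"
proof -
  note int = circle_char_mult_integrable[OF assms]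
  have "(LINT \<theta>|lborel. circle_char 0 \<theta> * g \<theta> * of_real ((cmod (\<Sum>i<J. v i * cis (real i * \<theta>)))\<^sup>2)) =
    (LINT \<theta>|lborel. (\<Sum>k<J. \<Sum>i<J. cnj (v k) * v i * (circle_char (int k - int i) \<theta> * g \<theta>)))"
    unfolding complex_norm_square
  proof (rule Bochner_Integration.integral_cong)
    fix \<theta>
    let ?V = "\<Sum>i<J. v i * cis (real i * \<theta>)"
    have "cnj ?V * ?V = (\<Sum>k<J. \<Sum>i<J. (cnj (v k) * cnj (cis (real k * \<theta>))) * (v i * cis (real i * \<theta>)))"
      by (simp add: sum_product)
    then have "circle_char 0 \<theta> * g \<theta> * (?V * cnj ?V) = circle_char 0 \<theta> * g \<theta> *
      (\<Sum>k<J. \<Sum>i<J. (cnj (v k) * cnj (cis (real k * \<theta>))) * (v i * cis (real i * \<theta>)))"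
      by (simp only: mult.commute)
    also have "\<dots> = (\<Sum>k<J. \<Sum>i<J. cnj (v k) * v i * (circle_char (int k - int i) \<theta> * g \<theta>))"
      unfolding sum_distrib_left circle_char_mult_cnj[symmetric] by (simp only: mult_ac)
    finally show "circle_char 0 \<theta> * g \<theta> * (?V * cnj ?V) =
      (\<Sum>k<J. \<Sum>i<J. cnj (v k) * v i * (circle_char (int k - int i) \<theta> * g \<theta>))" .
  qed simp
  also have "\<dots> = (\<Sum>k<J. \<Sum>i<J. cnj (v k) * v i * (LINT \<theta>|lborel. circle_char (int k - int i) \<theta> * g \<theta>))"
    by (simp add: Bochner_Integration.integral_sum int)
  finally show ?thesis by simp
qed

text \<open>The weight is at least exp(-N) pointwise, so its form dominates exp(-N) times the form
  for the constant weight 1. The constant depends neither on the size \<open>J\<close> nor on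
  \<open>n\<close>, which is the source of all later uniformity.\<close>

lemma toeplitz_coercive:
  fixes v :: "nat \<Rightarrow> complex"
  assumes n: "n \<ge> 1"
  shows "exp (- N) * (\<Sum>k<J. (cmod (v k))\<^sup>2) \<le> Re (\<Sum>k<J. \<Sum>i<J. cnj (v k) * v i * moment n (int k - int i))"
proof -
  let ?V = "\<lambda>\<theta>. (cmod (\<Sum>i<J. v i * cis (real i * \<theta>)))\<^sup>2"
  let ?c = "\<lambda>\<theta>::real. indicator {0..<2*pi} \<theta> / (2 * pi) :: real"
  have c: "circle_char 0 \<theta> = of_real (?c \<theta>)" for \<theta> by (simp add: circle_char_def)
  have V: "?V \<theta> \<le> (\<Sum>i<J. cmod (v i))\<^sup>2" for \<theta>
    by (intro power_mono sum_norm_le) (auto simp: norm_mult)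
  have [measurable]: "?V \<in> borel_measurable borel" by measurable
  have "of_real (\<Sum>k<J. (cmod (v k))\<^sup>2) = (\<Sum>k<J. \<Sum>i<J. cnj (v k) * v i * (LINT \<theta>|lborel. circle_char (int k - int i) \<theta> * 1))"
    by (simp add: circle_char_integral complex_norm_square if_distrib[of "\<lambda>x. _ * x"] sum.delta' mult.commute cong: if_cong del: of_real_power)
  also have "\<dots> = (LINT \<theta>|lborel. circle_char 0 \<theta> * 1 * of_real (?V \<theta>))"
    by (rule toeplitz_form[where B = 1]) auto
  also have "\<dots> = of_real (LINT \<theta>|lborel. ?c \<theta> * ?V \<theta>)"
    unfolding c by (simp only: mult_1_right of_real_mult[symmetric] integral_complex_of_real)
  finally have 1: "(\<Sum>k<J. (cmod (v k))\<^sup>2) = (LINT \<theta>|lborel. ?c \<theta> * ?V \<theta>)"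
    using of_real_eq_iff by blast
  have "(\<Sum>k<J. \<Sum>i<J. cnj (v k) * v i * moment n (int k - int i)) =
    (LINT \<theta>|lborel. circle_char 0 \<theta> * exp (exponent n \<theta>) * of_real (?V \<theta>))"
    unfolding moment_def
    by (rule toeplitz_form[where B = "exp N"])
      (use weight_bounds[OF n] order_trans[OF exp_ge_zero weight_bounds(1)[OF n]] in \<open>auto simp: exp_exponent\<close>)
  also have "\<dots> = of_real (LINT \<theta>|lborel. ?c \<theta> * weight n \<theta> * ?V \<theta>)"
    unfolding c exp_exponent by (simp only: of_real_mult[symmetric] integral_complex_of_real)
  finally have 2: "Re (\<Sum>k<J. \<Sum>i<J. cnj (v k) * v i * moment n (int k - int i)) = (LINT \<theta>|lborel. ?c \<theta> * weight n \<theta> * ?V \<theta>)"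
    by simp
  have bounded: "integrable lborel (\<lambda>\<theta>. ?c \<theta> * g \<theta>)" if "g \<in> borel_measurable borel" "\<And>\<theta>. \<bar>g \<theta>\<bar> \<le> B" for g B
  proof -
    have [measurable]: "g \<in> borel_measurable borel" by fact
    have "integrable lborel (\<lambda>\<theta>. circle_char 0 \<theta> * of_real (g \<theta>))"
      by (rule circle_char_mult_integrable[where B = B]) (measurable, simp add: that(2))
    then have "integrable lborel (\<lambda>\<theta>. complex_of_real (?c \<theta> * g \<theta>))"
      unfolding c of_real_mult .
    then show ?thesis by (rule iffD1[OF complex_of_real_integrable_eq])
  qed
  have "exp (- N) * (LINT \<theta>|lborel. ?c \<theta> * ?V \<theta>) = (LINT \<theta>|lborel. ?c \<theta> * (exp (- N) * ?V \<theta>))"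
    by (subst integral_mult_right_zero[symmetric]) (simp add: mult_ac)
  also have "\<dots> \<le> (LINT \<theta>|lborel. ?c \<theta> * (weight n \<theta> * ?V \<theta>))"
  proof (rule integral_mono)
    show "integrable lborel (\<lambda>\<theta>. ?c \<theta> * (exp (- N) * ?V \<theta>))"
      by (rule bounded[where B = "exp (- N) * (\<Sum>i<J. cmod (v i))\<^sup>2"]) (measurable, simp only: abs_mult abs_exp_cancel abs_power2 abs_ge_zero, intro mult_left_mono V exp_ge_zero)
    show "integrable lborel (\<lambda>\<theta>. ?c \<theta> * (weight n \<theta> * ?V \<theta>))"
    proof (rule bounded[where B = "exp N * (\<Sum>i<J. cmod (v i))\<^sup>2"])
      show "\<bar>weight n \<theta> * ?V \<theta>\<bar> \<le> exp N * (\<Sum>i<J. cmod (v i))\<^sup>2" for \<theta>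
        unfolding abs_mult using weight_bounds[OF n, of \<theta>] order_trans[OF exp_ge_zero weight_bounds(1)[OF n, of \<theta>]] V[of \<theta>]
        by (intro mult_mono) auto
    qed measurable
    show "?c \<theta> * (exp (- N) * ?V \<theta>) \<le> ?c \<theta> * (weight n \<theta> * ?V \<theta>)" for \<theta>
      using weight_bounds(1)[OF n, of \<theta>] by (intro mult_left_mono mult_right_mono) auto
  qed
  finally show ?thesis unfolding 1 2 by (simp add: mult.assoc)
qed

text \<open>The \<open>\<ell>\<^sup>2\<close> bound coming from coercivity controls the \<open>\<ell>\<^sup>1\<close> norm of \<open>v\<close> by Cauchy-Schwarz; as the
  off-diagonal entries are \<open>O(h)\<close>, the equation itself turns this into a sup bound.\<close>

lemma toeplitz_stable:
  fixes v :: "nat \<Rightarrow> complex"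
  assumes n: "n \<ge> 1"
    and b: "\<And>k. k < J \<Longrightarrow> cmod (v k + (\<Sum>i<J. of_real (R / real n) * (mesh_exp n (of_int (int k - int i) * (R / real n)) * v i))) \<le> \<beta>"
    and k: "k < J"
  shows "cmod (v k) \<le> \<beta> * (1 + C * exp N * (real J * (R / real n)))"
proof -
  let ?h = "R / real n"
  let ?L = "\<lambda>k i. mesh_exp n (of_int (int k - int i) * ?h)"
  define S where "S = (\<Sum>i<J. cmod (v i))"
  have S: "0 \<le> S" unfolding S_def by (intro sum_nonneg) auto
  have \<beta>: "0 \<le> \<beta>" using order_trans[OF norm_ge_zero b[OF k]] .
  have row: "(\<Sum>i<J. moment n (int k - int i) * v i) = v k + (\<Sum>i<J. of_real ?h * (?L k i * v i))" if "k < J" for k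
    using that by (simp add: moment_eq[OF n] distrib_right sum.distrib if_distrib[of "\<lambda>x. x * _"] mult.assoc cong: if_cong)
  have "exp (- N) * (\<Sum>k<J. (cmod (v k))\<^sup>2) \<le> Re (\<Sum>k<J. \<Sum>i<J. cnj (v k) * v i * moment n (int k - int i))"
    by (rule toeplitz_coercive[OF n])
  also have "(\<Sum>k<J. \<Sum>i<J. cnj (v k) * v i * moment n (int k - int i)) = (\<Sum>k<J. cnj (v k) * (\<Sum>i<J. moment n (int k - int i) * v i))"
    by (simp add: sum_distrib_left mult_ac)
  also have "Re \<dots> \<le> cmod \<dots>" by (rule complex_Re_le_cmod)
  also have "\<dots> \<le> (\<Sum>k<J. cmod (v k) * \<beta>)"
  proof (rule sum_norm_le)
    fix k assume "k \<in> {..<J}"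
    then have k: "k < J" by simp
    show "cmod (cnj (v k) * (\<Sum>i<J. moment n (int k - int i) * v i)) \<le> cmod (v k) * \<beta>"
      unfolding norm_mult complex_mod_cnj row[OF k] by (intro mult_left_mono b[OF k] norm_ge_zero)
  qed
  also have "\<dots> = \<beta> * S" by (simp add: S_def sum_distrib_left mult.commute)
  finally have "exp N * (exp (- N) * (\<Sum>k<J. (cmod (v k))\<^sup>2)) \<le> exp N * (\<beta> * S)"
    by (intro mult_left_mono exp_ge_zero)
  then have e: "(\<Sum>k<J. (cmod (v k))\<^sup>2) \<le> exp N * (\<beta> * S)"
    unfolding mult.assoc[symmetric] exp_add[symmetric] by simp
  have "S\<^sup>2 \<le> real J * (\<Sum>k<J. (cmod (v k))\<^sup>2)"
    using Cauchy_Schwarz_ineq_sum[of "\<lambda>_. 1" "\<lambda>i. cmod (v i)" "{..<J}"] by (simp add: S_def)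
  also have "\<dots> \<le> real J * (exp N * (\<beta> * S))"
    using e by (intro mult_left_mono) auto
  finally have SS: "S * S \<le> (real J * exp N * \<beta>) * S" by (simp only: power2_eq_square mult.assoc)
  have S2: "S \<le> real J * exp N * \<beta>"
  proof (cases "S = 0")
    case True
    then show ?thesis using \<beta> by (simp only:) (intro mult_nonneg_nonneg; simp)
  next
    case False
    then show ?thesis using mult_right_le_imp_le[OF SS] S by simp
  qed
  have h: "0 \<le> ?h" using R_pos by simp
  let ?X = "\<Sum>i<J. of_real ?h * (?L k i * v i)"
  have "cmod (of_real ?h * (?L k i * v i)) \<le> ?h * (C * cmod (v i))" for i
    unfolding norm_mult norm_of_real abs_of_nonneg[OF h]
    by (rule mult_left_mono[OF mult_right_mono[OF mesh_exp_bound[OF n] norm_ge_zero] h])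
  then have "cmod ?X \<le> (\<Sum>i<J. ?h * (C * cmod (v i)))" by (intro sum_norm_le)
  also have "\<dots> = ?h * C * S" by (simp only: S_def sum_distrib_left mult.assoc)
  also have "\<dots> \<le> ?h * C * (real J * exp N * \<beta>)"
    by (intro mult_left_mono S2 mult_nonneg_nonneg h C_nonneg)
  finally have X: "cmod ?X \<le> ?h * C * (real J * exp N * \<beta>)" .
  have "cmod (v k) \<le> cmod (v k + ?X) + cmod ?X" using norm_triangle_ineq4[of "v k + ?X" ?X] by simp
  also have "\<dots> \<le> \<beta> + ?h * C * (real J * exp N * \<beta>)" by (rule add_mono[OF b[OF k] X])
  also have "\<dots> = \<beta> * (1 + C * exp N * (real J * ?h))" by (simp only: distrib_left mult_1_right mult_ac)
  finally show ?thesis .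
qed

end

section \<open>Identification of the accelerant\<close>

lemma tent_measurable [measurable]: "tent t \<in> borel_measurable borel"
  unfolding tent_def[abs_def] by measurable

lemma tent_integrable: "integrable lborel (\<lambda>y. tent t (x + y))"
proof -
  have "integrable lborel (tent t)"
  proof (rule Bochner_Integration.integrable_bound)
    show "integrable lborel (\<lambda>y. indicator {-\<bar>t\<bar>..\<bar>t\<bar>} y * \<bar>t\<bar> :: real)" by (intro integrable_mult_left) auto
  qed (auto simp: tent_def split: split_indicator)
  from lborel_integrable_real_affine[OF this, of 1 x] show ?thesis by simp
qed

text \<open>The tent is the Peano kernel of the second central difference: integration by parts on
  each side of the peak. The choice of primitives is free, since affine terms have no second
  difference.\<close>

lemma tent_integral_second_difference:
  fixes H H1 H2 :: "real \<Rightarrow> complex"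
  assumes H: "continuous_on UNIV H" and H1: "\<And>x. (H1 has_vector_derivative H x) (at x)"
    and H2: "\<And>x. (H2 has_vector_derivative H1 x) (at x)" and t: "t \<ge> 0"
  shows "(LINT s|lborel. H s * tent t (x - s)) = H2 (x + t) + H2 (x - t) - 2 * H2 x"
proof -
  have l: "has_bochner_integral lborel (\<lambda>s. indicator {x - t..x} s *\<^sub>R (of_real (t - x + s) * H s))
      ((of_real (t - x + x) * H1 x - H2 x) - (of_real (t - x + (x - t)) * H1 (x - t) - H2 (x - t)))"
    using t by (intro has_bochner_integral_FTC_Icc continuous_intros continuous_on_subset[OF H])
      (auto intro!: derivative_eq_intros has_vector_derivative_at_within[OF H1] has_vector_derivative_at_within[OF H2]
        has_vector_derivative_of_real simp: algebra_simps)
  have r: "has_bochner_integral lborel (\<lambda>s. indicator {x..x + t} s *\<^sub>R (of_real (t + x - s) * H s))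
      ((of_real (t + x - (x + t)) * H1 (x + t) + H2 (x + t)) - (of_real (t + x - x) * H1 x + H2 x))"
    using t by (intro has_bochner_integral_FTC_Icc continuous_intros continuous_on_subset[OF H])
      (auto intro!: derivative_eq_intros has_vector_derivative_at_within[OF H1] has_vector_derivative_at_within[OF H2]
        has_vector_derivative_of_real simp: algebra_simps)
  have "(LINT s|lborel. H s * tent t (x - s)) =
    (LINT s|lborel. indicator {x - t..x} s *\<^sub>R (of_real (t - x + s) * H s) + indicator {x..x + t} s *\<^sub>R (of_real (t + x - s) * H s))"
  proof (rule integral_cong_AE)
    have [measurable]: "H \<in> borel_measurable borel" using H by (rule borel_measurable_continuous_onI)
    show "(\<lambda>s. H s * tent t (x - s)) \<in> borel_measurable lborel" by measurable
    show "(\<lambda>s. indicator {x - t..x} s *\<^sub>R (of_real (t - x + s) * H s) + indicator {x..x + t} s *\<^sub>R (of_real (t + x - s) * H s)) \<in> borel_measurable lborel"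
      by measurable
    show "AE s in lborel. H s * tent t (x - s) = indicator {x - t..x} s *\<^sub>R (of_real (t - x + s) * H s) + indicator {x..x + t} s *\<^sub>R (of_real (t + x - s) * H s)"
      using AE_lborel_singleton[of x]
    proof eventually_elim
      case (elim s)
      then show ?case by (cases "s < x") (auto simp: tent_def max_def split: split_indicator)
    qed
  qed
  also have "\<dots> = H2 (x + t) + H2 (x - t) - 2 * H2 x"
    using has_bochner_integral_add[OF l r] by (simp add: has_bochner_integral_iff algebra_simps)
  finally show ?thesis .
qed

text \<open>The integral in the definition of the accelerant is a double primitive of
  \<open>H\<close>, up to an affine function that second differences will remove.\<close>

lemma krein_double_primitive:
  fixes H H1 H2 :: "real \<Rightarrow> complex"
  assumes H: "continuous_on UNIV H" and H1: "\<And>x. (H1 has_vector_derivative H x) (at x)"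
    and H2: "\<And>x. (H2 has_vector_derivative H1 x) (at x)"
  shows "(LBINT s=0..ereal x. of_real (x - s) * H s) = H2 x - H2 0 - of_real x * H1 0"
proof -
  have "(LBINT s=ereal 0..ereal x. of_real (x - s) * H s) = (of_real (x - x) * H1 x + H2 x) - (of_real (x - 0) * H1 0 + H2 0)"
    by (intro interval_integral_FTC_finite continuous_intros continuous_on_subset[OF H])
      (auto intro!: derivative_eq_intros has_vector_derivative_at_within[OF H1] has_vector_derivative_at_within[OF H2]
        has_vector_derivative_of_real simp: algebra_simps)
  then show ?thesis by (simp add: zero_ereal_def)
qed

lemma primitive_exists:
  fixes H :: "real \<Rightarrow> complex"
  assumes "continuous_on UNIV H"
  obtains H1 where "\<And>x. (H1 has_vector_derivative H x) (at x)" "continuous_on UNIV H1"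
proof -
  obtain H1 where 1: "\<And>x. (H1 has_vector_derivative H x) (at x)"
    using einterval_antiderivative[of "-\<infinity>" "\<infinity>" H] assms by (auto simp: continuous_on_eq_continuous_at)
  then have "continuous_on UNIV H1"
    by (auto simp: continuous_on_eq_continuous_at intro: has_vector_derivative_continuous)
  with 1 show ?thesis by (rule that)
qed

text \<open>Differentiating the equality of second differences in \<open>t\<close> shows that \<open>H1 - K1\<close> is constant.\<close>

lemma eq_from_tent_integrals:
  fixes H K H1 K1 H2 K2 :: "real \<Rightarrow> complex"
  assumes H1: "\<And>x. (H1 has_vector_derivative H x) (at x)" and H2: "\<And>x. (H2 has_vector_derivative H1 x) (at x)"
    and K1: "\<And>x. (K1 has_vector_derivative K x) (at x)" and K2: "\<And>x. (K2 has_vector_derivative K1 x) (at x)"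
    and eq: "\<And>x t. t \<ge> 0 \<Longrightarrow> H2 (x + t) + H2 (x - t) - 2 * H2 x = K2 (x + t) + K2 (x - t) - 2 * K2 x"
  shows "H x = K x"
proof -
  let ?g = "\<lambda>x. H1 x - K1 x"
  have g: "?g (x + t) = ?g (x - t)" if t: "t > 0" for x t
  proof -
    let ?D = "\<lambda>\<tau>. (H2 (x + \<tau>) + H2 (x - \<tau>) - 2 * H2 x) - (K2 (x + \<tau>) + K2 (x - \<tau>) - 2 * K2 x)"
    have p: "((\<lambda>\<tau>. G (x + \<tau>)) has_vector_derivative G' (x + t)) (at t)"
      and m: "((\<lambda>\<tau>. G (x - \<tau>)) has_vector_derivative - G' (x - t)) (at t)"
      if "\<And>x. (G has_vector_derivative G' x) (at x)" for G G' :: "real \<Rightarrow> complex"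
    proof -
      have p0: "((\<lambda>\<tau>. x + \<tau>) has_vector_derivative 1) (at t)" by (auto intro!: derivative_eq_intros)
      show "((\<lambda>\<tau>. G (x + \<tau>)) has_vector_derivative G' (x + t)) (at t)"
        using vector_diff_chain_at[OF p0 that] by (simp add: comp_def)
      have "((\<lambda>\<tau>. x - \<tau>) has_vector_derivative - 1) (at t)" by (auto intro!: derivative_eq_intros)
      from vector_diff_chain_at[OF this that]
      show "((\<lambda>\<tau>. G (x - \<tau>)) has_vector_derivative - G' (x - t)) (at t)"
        by (simp add: comp_def)
    qed
    have "(?D has_vector_derivative (H1 (x + t) + - H1 (x - t) - 0) - (K1 (x + t) + - K1 (x - t) - 0)) (at t)"
      by (intro has_vector_derivative_diff has_vector_derivative_add p m H2 K2 has_vector_derivative_const)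
    moreover have "(?D has_vector_derivative 0) (at t)"
      by (rule has_vector_derivative_transform_within_open[of "\<lambda>_. 0" _ _ "{0<..}"]) (use t eq in auto)
    ultimately have "(H1 (x + t) + - H1 (x - t) - 0) - (K1 (x + t) + - K1 (x - t) - 0) = 0"
      by (rule vector_derivative_unique_at)
    then show ?thesis by (simp add: algebra_simps)
  qed
  \<comment> \<open>The points \<open>y\<close> and 0 are symmetric about
    \<open>y / 2\<close>.\<close>
  have c: "?g y = ?g 0" for y
    using g[of "\<bar>y\<bar> / 2" "y / 2"] by (cases y "0::real" rule: linorder_cases) auto
  have "(?g has_vector_derivative H x - K x) (at x)" by (intro has_vector_derivative_diff H1 K1)
  moreover have "(?g has_vector_derivative 0) (at x)" by (subst c) auto
  ultimately have "H x - K x = 0" by (rule vector_derivative_unique_at)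
  then show ?thesis by simp
qed

lemma krein_kernel_measurable [measurable]: "krein_kernel x \<in> borel_measurable borel"
  unfolding krein_kernel_def[abs_def] by measurable

text \<open>This makes the kernel integrable for every measure that integrates 1/(1+\<xi>^2). Near 0
  the second-order Taylor remainder bounds the kernel, at infinity a trivial estimate bounds \<xi>^2
  times the kernel, and the sum of the two bounds gives the claim. The constants are not
  sharp.\<close>

lemma krein_kernel_bound: "cmod (krein_kernel x \<xi>) \<le> (x\<^sup>2 + 2 * \<bar>x\<bar> + 4) / (1 + \<xi>\<^sup>2)"
proof (cases "\<xi> = 0")
  case True
  then show ?thesis by (simp add: krein_kernel_def norm_power)
next
  case False
  define u where "u = \<xi> * x"
  have e: "cmod (1 + \<i> * of_real u - exp (\<i> * of_real u)) \<le> u\<^sup>2 / 2"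
    using iexp_approx1[of u 1] by (simp add: norm_minus_commute power2_eq_square)
  have e0: "cmod (exp (\<i> * of_real u)) = 1" by simp
  have q: "1 + \<xi>\<^sup>2 > 0" by (simp add: add_pos_nonneg)
  have k: "krein_kernel x \<xi> = (1 + \<i> * of_real u / of_real (1 + \<xi>\<^sup>2) - exp (\<i> * of_real u)) / of_real (\<xi>\<^sup>2)"
    using False by (simp add: krein_kernel_def u_def)
  have kk: "cmod (krein_kernel x \<xi>) * \<xi>\<^sup>2 = cmod (1 + \<i> * of_real u / of_real (1 + \<xi>\<^sup>2) - exp (\<i> * of_real u))"
    unfolding k norm_divide norm_of_real using False by simp
  \<comment> \<open>Replacing the regularized linear term by the full one exposes the Taylor
    remainder of the exponential; the difference still carries a factor \<xi>^2.\<close>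
  have "u / (1 + \<xi>\<^sup>2) = u - u * (\<xi>\<^sup>2 / (1 + \<xi>\<^sup>2))"
    using q by (simp add: divide_simps) (simp add: algebra_simps)
  then have "\<i> * of_real u / of_real (1 + \<xi>\<^sup>2) = \<i> * (of_real u - of_real (u * (\<xi>\<^sup>2 / (1 + \<xi>\<^sup>2))))"
    by (simp only: of_real_divide[symmetric] of_real_diff[symmetric] times_divide_eq_right[symmetric])
  then have "1 + \<i> * of_real u / of_real (1 + \<xi>\<^sup>2) - exp (\<i> * of_real u) =
     (1 + \<i> * of_real u - exp (\<i> * of_real u)) - \<i> * of_real (u * (\<xi>\<^sup>2 / (1 + \<xi>\<^sup>2)))"
    by (simp only: right_diff_distrib) (simp only: diff_conv_add_uminus add_ac)
  then have "cmod (1 + \<i> * of_real u / of_real (1 + \<xi>\<^sup>2) - exp (\<i> * of_real u)) \<le> u\<^sup>2 / 2 + \<bar>u\<bar> * (\<xi>\<^sup>2 / (1 + \<xi>\<^sup>2))"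
    using norm_triangle_ineq4[of "1 + \<i> * of_real u - exp (\<i> * of_real u)" "\<i> * of_real (u * (\<xi>\<^sup>2 / (1 + \<xi>\<^sup>2)))"] e q
    by (simp only: norm_mult norm_ii norm_of_real abs_mult) simp
  then have a: "cmod (krein_kernel x \<xi>) * \<xi>\<^sup>2 \<le> u\<^sup>2 / 2 + \<bar>u\<bar> * (\<xi>\<^sup>2 / (1 + \<xi>\<^sup>2))"
    unfolding kk .
  have "cmod (\<i> * of_real u / of_real (1 + \<xi>\<^sup>2)) = \<bar>u\<bar> / (1 + \<xi>\<^sup>2)"
    unfolding norm_divide norm_mult norm_of_real using q by simp
  then have "cmod (1 + \<i> * of_real u / of_real (1 + \<xi>\<^sup>2) - exp (\<i> * of_real u)) \<le> 2 + \<bar>u\<bar> / (1 + \<xi>\<^sup>2)"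
    using norm_triangle_ineq4[of "1 + \<i> * of_real u / of_real (1 + \<xi>\<^sup>2)" "exp (\<i> * of_real u)"]
      norm_triangle_ineq[of 1 "\<i> * of_real u / of_real (1 + \<xi>\<^sup>2)"] e0 norm_one[where 'a = complex] by linarith
  then have b: "cmod (krein_kernel x \<xi>) * \<xi>\<^sup>2 \<le> 2 + \<bar>u\<bar> / (1 + \<xi>\<^sup>2)"
    unfolding kk .
  have u: "u\<^sup>2 = x\<^sup>2 * \<xi>\<^sup>2" by (simp add: u_def power_mult_distrib)
  have x1: "\<bar>u\<bar> / (1 + \<xi>\<^sup>2) \<le> \<bar>x\<bar> / 2"
  proof -
    have "2 * \<bar>\<xi>\<bar> \<le> 1 + \<xi>\<^sup>2" using sum_squares_bound[of 1 "\<bar>\<xi>\<bar>"] by simp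
    then have "\<bar>x\<bar> * (2 * \<bar>\<xi>\<bar>) \<le> \<bar>x\<bar> * (1 + \<xi>\<^sup>2)" by (intro mult_left_mono) auto
    then have "\<bar>u\<bar> \<le> \<bar>x\<bar> / 2 * (1 + \<xi>\<^sup>2)" unfolding u_def abs_mult by (simp add: mult.commute mult.left_commute)
    then show ?thesis using q by (simp only: pos_divide_le_eq)
  qed
  have "cmod (krein_kernel x \<xi>) * \<xi>\<^sup>2 \<le> (x\<^sup>2 / 2 + \<bar>x\<bar> / 2) * \<xi>\<^sup>2"
  proof -
    have "\<bar>u\<bar> / (1 + \<xi>\<^sup>2) * \<xi>\<^sup>2 \<le> \<bar>x\<bar> / 2 * \<xi>\<^sup>2" by (rule mult_right_mono[OF x1]) simp
    moreover have "\<bar>u\<bar> / (1 + \<xi>\<^sup>2) * \<xi>\<^sup>2 = \<bar>u\<bar> * (\<xi>\<^sup>2 / (1 + \<xi>\<^sup>2))"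
      "x\<^sup>2 * \<xi>\<^sup>2 / 2 = x\<^sup>2 / 2 * \<xi>\<^sup>2" by simp_all
    ultimately show ?thesis using a unfolding u distrib_right by linarith
  qed
  then have c: "cmod (krein_kernel x \<xi>) \<le> x\<^sup>2 / 2 + \<bar>x\<bar> / 2"
    by (rule mult_right_le_imp_le) (use False in simp)
  have "cmod (krein_kernel x \<xi>) * (1 + \<xi>\<^sup>2) \<le> x\<^sup>2 + 2 * \<bar>x\<bar> + 4"
  proof -
    have "cmod (krein_kernel x \<xi>) * (1 + \<xi>\<^sup>2) = cmod (krein_kernel x \<xi>) + cmod (krein_kernel x \<xi>) * \<xi>\<^sup>2"
      by (simp only: distrib_left mult_1_right)
    also have "\<dots> \<le> (x\<^sup>2 / 2 + \<bar>x\<bar> / 2) + (2 + \<bar>x\<bar> / 2)" using b c x1 by linarith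
    also have "\<dots> \<le> x\<^sup>2 + 2 * \<bar>x\<bar> + 4" by (simp add: field_simps)
    finally show ?thesis .
  qed
  then show ?thesis using q by (simp add: pos_le_divide_eq)
qed

text \<open>The constant and the linear regularization cancel, leaving 2 - 2 cos(t\<xi>) times the
  character. At \<xi> = 0 the left side is t^2 while \<open>fejer t 0\<close> is 0, so that point is
  excluded.\<close>

lemma krein_kernel_second_difference:
  assumes "\<xi> \<noteq> 0"
  shows "krein_kernel (x + t) \<xi> + krein_kernel (x - t) \<xi> - 2 * krein_kernel x \<xi> =
    of_real (2 * pi) * (fejer t \<xi> * exp (\<i> * of_real (\<xi> * x)))"
proof -
  have p: "exp (\<i> * of_real (\<xi> * (x + t))) = exp (\<i> * of_real (\<xi> * x)) * exp (\<i> * of_real (t * \<xi>))"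
    and m: "exp (\<i> * of_real (\<xi> * (x - t))) = exp (\<i> * of_real (\<xi> * x)) * exp (- (\<i> * of_real (t * \<xi>)))"
    by (simp_all add: algebra_simps flip: exp_add)
  have c: "exp (\<i> * of_real (t * \<xi>)) + exp (- (\<i> * of_real (t * \<xi>))) = 2 * of_real (cos (t * \<xi>))"
    by (simp add: complex_eq_iff Re_exp Im_exp)
  define E where "E = exp (\<i> * complex_of_real (\<xi> * x))"
  define w where "w y = \<i> * complex_of_real (\<xi> * y) / of_real (1 + \<xi>\<^sup>2)" for y
  have w: "w (x + t) + w (x - t) = 2 * w x"
    unfolding w_def add_divide_distrib[symmetric] by (simp add: algebra_simps)
  have "krein_kernel (x + t) \<xi> + krein_kernel (x - t) \<xi> - 2 * krein_kernel x \<xi> =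
    ((1 + w (x + t) - E * exp (\<i> * of_real (t * \<xi>))) + (1 + w (x - t) - E * exp (- (\<i> * of_real (t * \<xi>)))) - 2 * (1 + w x - E)) / of_real (\<xi>\<^sup>2)"
    using assms unfolding krein_kernel_def p m E_def[symmetric] w_def[symmetric]
    by (simp only: if_False times_divide_eq_right) (simp only: add_divide_distrib diff_divide_distrib)
  also have "(1 + w (x + t) - E * exp (\<i> * of_real (t * \<xi>))) + (1 + w (x - t) - E * exp (- (\<i> * of_real (t * \<xi>)))) - 2 * (1 + w x - E)
     = E * (2 - (exp (\<i> * of_real (t * \<xi>)) + exp (- (\<i> * of_real (t * \<xi>))))) + (w (x + t) + w (x - t) - 2 * w x)"
    by (simp only: algebra_simps) simp
  also have "\<dots> = E * (2 - 2 * of_real (cos (t * \<xi>)))" unfolding c w by simp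
  also have "\<dots> / of_real (\<xi>\<^sup>2) = of_real (2 * pi) * (fejer t \<xi> * E)"
    using assms by (simp add: fejer_def divide_simps)
  finally show ?thesis unfolding E_def .
qed

section \<open>Powers of the transform of \<open>l\<close> paired with the Fejer kernel\<close>

context hermitian_cutoff
begin

definition lhat :: "real \<Rightarrow> complex" where
  "lhat \<xi> = (LINT x|lborel. l x * exp (\<i> * of_real (\<xi> * x)))"

lemma lhat_measurable [measurable]: "lhat \<in> borel_measurable borel"
  unfolding lhat_def[abs_def] by measurable

lemma lhat_bound: "cmod (lhat \<xi>) \<le> N"
  unfolding lhat_def using l_mult_integral_bound[of "\<lambda>x. exp (\<i> * of_real (\<xi> * x))" 1] by simp

lemma lhat_real: "lhat \<xi> \<in> \<real>"
proof -
  have "cnj (lhat \<xi>) = (LINT x|lborel. cnj (l x * exp (\<i> * of_real (\<xi> * x))))"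
    unfolding lhat_def by (rule Bochner_Integration.integral_cnj[symmetric])
  also have "\<dots> = (LINT x|lborel. l (- x) * exp (\<i> * of_real (\<xi> * (- x))))"
    by (simp add: l_herm exp_cnj)
  also have "\<dots> = lhat \<xi>"
    unfolding lhat_def using lborel_integral_real_affine[of "-1" "\<lambda>x. l x * exp (\<i> * of_real (\<xi> * x))" 0] by simp
  finally show ?thesis by (simp add: Reals_cnj_iff)
qed

lemma exp_lhat: "exp (lhat \<xi>) = of_real (Re (exp (lhat \<xi>)))" "Re (exp (lhat \<xi>)) > 0"
proof -
  obtain r where "lhat \<xi> = of_real r" using lhat_real[of \<xi>] by (auto elim: Reals_cases)
  then show "exp (lhat \<xi>) = of_real (Re (exp (lhat \<xi>)))" "Re (exp (lhat \<xi>)) > 0"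
    by (simp_all add: Re_exp flip: exp_of_real)
qed

lemma fejer_exp_integrable: "integrable lborel (\<lambda>\<xi>. fejer t \<xi> * exp (\<i> * of_real (\<xi> * x)))"
  by (rule Bochner_Integration.integrable_bound[OF fejer_integrable[of t]])
    (use borel_measurable_integrable[OF fejer_integrable[of t]] in \<open>auto simp: norm_mult\<close>)

text \<open>One factor \<open>lhat\<close> is written as its defining integral; its character merges
  with the one already present, so each factor becomes an average over translates of
  \<open>x\<close> weighted by \<open>l\<close>.\<close>

lemma fejer_power_shift:
  "(LINT \<xi>|lborel. fejer t \<xi> * exp (\<i> * of_real (\<xi> * x)) * lhat \<xi> ^ Suc m) =
   (LINT y|lborel. l y * (LINT \<xi>|lborel. fejer t \<xi> * exp (\<i> * of_real (\<xi> * (x + y))) * lhat \<xi> ^ m))"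
proof -
  have "fejer t \<xi> * exp (\<i> * of_real (\<xi> * x)) * lhat \<xi> ^ Suc m =
     fejer t \<xi> * (LINT y|lborel. l y * (exp (\<i> * of_real (\<xi> * (x + y))) * lhat \<xi> ^ m))" for \<xi>
  proof -
    have "(LINT y|lborel. l y * (exp (\<i> * of_real (\<xi> * (x + y))) * lhat \<xi> ^ m)) =
      (LINT y|lborel. (exp (\<i> * of_real (\<xi> * x)) * lhat \<xi> ^ m) * (l y * exp (\<i> * of_real (\<xi> * y))))"
      by (rule Bochner_Integration.integral_cong) (simp_all add: distrib_left exp_add)
    also have "\<dots> = (exp (\<i> * of_real (\<xi> * x)) * lhat \<xi> ^ m) * lhat \<xi>"
      by (simp add: lhat_def)
    finally show ?thesis by (simp add: mult_ac)
  qed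
  then have "(LINT \<xi>|lborel. fejer t \<xi> * exp (\<i> * of_real (\<xi> * x)) * lhat \<xi> ^ Suc m) =
    (LINT \<xi>|lborel. fejer t \<xi> * (LINT y|lborel. l y * (exp (\<i> * of_real (\<xi> * (x + y))) * lhat \<xi> ^ m)))" by (simp only:)
  also have "\<dots> = (LINT y|lborel. l y * (LINT \<xi>|lborel. fejer t \<xi> * (exp (\<i> * of_real (\<xi> * (x + y))) * lhat \<xi> ^ m)))"
  proof (rule integral_product_swap_bounded[OF fejer_integrable l_integrable])
    show "cmod (exp (\<i> * of_real (\<xi> * (x + y))) * lhat \<xi> ^ m) \<le> N ^ m" for \<xi> y
      by (simp add: norm_mult norm_power power_mono lhat_bound)
  qed measurable
  finally show ?thesis by (simp add: mult.assoc)
qed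

text \<open>A Parseval identity that needs only the explicit transform of the Fejer kernel. By
  induction the translates from \<open>fejer_power_shift\<close> are moved onto the convolution
  power. The pairing is with \<open>tent t (x + y)\<close>, not with \<open>x - y\<close>, which is
  where the later reflection comes from.\<close>

lemma fejer_power:
  assumes t: "t \<ge> 0"
  shows "(LINT \<xi>|lborel. fejer t \<xi> * exp (\<i> * of_real (\<xi> * x)) * lhat \<xi> ^ Suc m) = (LINT y|lborel. conv_pow m y * tent t (x + y))"
proof (induction m arbitrary: x)
  case 0
  show ?case unfolding fejer_power_shift by (simp add: fejer_transform[OF t] del: of_real_mult of_real_add)
next
  case (Suc m)
  have "(LINT \<xi>|lborel. fejer t \<xi> * exp (\<i> * of_real (\<xi> * x)) * lhat \<xi> ^ Suc (Suc m)) =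
    (LINT y|lborel. l y * (LINT z|lborel. tent t (x + z) * conv_pow m (z - y)))"
  proof (subst fejer_power_shift, rule Bochner_Integration.integral_cong)
    fix y
    have "(LINT z|lborel. conv_pow m z * tent t (x + y + z)) = (LINT z|lborel. conv_pow m (z - y) * tent t (x + z))"
      using lborel_integral_real_affine[of 1 "\<lambda>z. conv_pow m z * tent t (x + y + z)" "- y"] by (simp add: algebra_simps)
    then show "l y * (LINT \<xi>|lborel. fejer t \<xi> * exp (\<i> * of_real (\<xi> * (x + y))) * lhat \<xi> ^ Suc m) =
      l y * (LINT z|lborel. tent t (x + z) * conv_pow m (z - y))"
      unfolding Suc by (simp add: mult.commute)
  qed simp
  also have "\<dots> = (LINT z|lborel. tent t (x + z) * (LINT y|lborel. l y * conv_pow m (z - y)))"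
    by (rule integral_product_swap_bounded[OF l_integrable tent_integrable]) (measurable, rule conv_pow_bound)
  also have "\<dots> = (LINT z|lborel. conv_pow (Suc m) z * tent t (x + z))" by (simp add: mult.commute)
  finally show ?case .
qed

lemma conv_exp_tent_sums:
  "(\<lambda>m. (LINT y|lborel. conv_pow m y * tent t (x + y)) / fact (Suc m)) sums (LINT y|lborel. conv_exp y * tent t (x + y))"
proof -
  let ?f = "\<lambda>m y. conv_pow m y / fact (Suc m) * tent t (x + y)"
  have b: "cmod (?f m y) \<le> (M * (N ^ m / fact m)) * cmod (tent t (x + y))" for m y
    unfolding norm_mult by (intro mult_right_mono term_bound conv_pow_bound) auto
  have ti: "integrable lborel (\<lambda>y. (M * (N ^ m / fact m)) * cmod (tent t (x + y)))" for m
    by (intro integrable_mult_right integrable_norm tent_integrable)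
  have i: "integrable lborel (?f m)" for m
  proof (rule Bochner_Integration.integrable_bound[OF ti])
    show "AE y in lborel. norm (?f m y) \<le> norm ((M * (N ^ m / fact m)) * cmod (tent t (x + y)))"
      by (intro AE_I2, rule order_trans[OF b], unfold real_norm_def, rule abs_ge_self)
  qed measurable
  have "(\<lambda>m. LINT y|lborel. ?f m y) sums (LINT y|lborel. (\<Sum>m. ?f m y))"
  proof (rule sums_integral[OF i])
    show "AE y in lborel. summable (\<lambda>m. norm (?f m y))"
    proof (rule AE_I2, rule summable_comparison_test'[OF summable_mult2[OF sums_summable[OF term_sums]]])
      show "norm (norm (?f m y)) \<le> (M * (N ^ m / fact m)) * cmod (tent t (x + y))" for m y
        using b[of m y] by (simp only: real_norm_def abs_norm_cancel)
    qed
    show "summable (\<lambda>m. LINT y|lborel. norm (?f m y))"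
    proof (rule summable_comparison_test'[OF summable_mult2[OF sums_summable[OF term_sums]]])
      fix m :: nat
      have "(LINT y|lborel. norm (?f m y)) \<le> (LINT y|lborel. (M * (N ^ m / fact m)) * cmod (tent t (x + y)))"
        by (intro integral_mono integrable_norm i ti b)
      then show "norm (LINT y|lborel. norm (?f m y)) \<le> (M * (N ^ m / fact m)) * (LINT y|lborel. cmod (tent t (x + y)))"
        by (simp only: real_norm_def abs_of_nonneg[OF Bochner_Integration.integral_nonneg[OF norm_ge_zero]] integral_mult_right_zero)
    qed
  qed
  moreover have "(\<Sum>m. ?f m y) = conv_exp y * tent t (x + y)" for y
    using sums_mult2[OF conv_exp_sums, of y "tent t (x + y)"] by (simp add: sums_iff)
  ultimately show ?thesis by (simp del: fact_Suc)
qed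

text \<open>The constant term of the exponential series contributes the isolated tent; it will
  cancel the second difference of |x|/2 in the equation for the accelerant.\<close>

lemma fejer_exp_lhat:
  assumes t: "t \<ge> 0"
  shows "(LINT \<xi>|lborel. fejer t \<xi> * exp (\<i> * of_real (\<xi> * x)) * exp (lhat \<xi>)) = tent t x + (LINT y|lborel. conv_exp y * tent t (x + y))"
proof -
  have "(\<lambda>m. (LINT \<xi>|lborel. fejer t \<xi> * exp (\<i> * of_real (\<xi> * x)) * lhat \<xi> ^ m) / fact m) sums
     (LINT \<xi>|lborel. fejer t \<xi> * exp (\<i> * of_real (\<xi> * x)) * exp (lhat \<xi>))"
    by (rule integral_exp_series[OF fejer_exp_integrable _ lhat_bound]) measurable
  then have "(\<lambda>m. (LINT \<xi>|lborel. fejer t \<xi> * exp (\<i> * of_real (\<xi> * x)) * lhat \<xi> ^ Suc m) / fact (Suc m)) sums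
     ((LINT \<xi>|lborel. fejer t \<xi> * exp (\<i> * of_real (\<xi> * x)) * exp (lhat \<xi>)) - tent t x)"
    by (subst sums_Suc_iff) (simp add: fejer_transform[OF t] del: of_real_mult of_real_add power_Suc fact_Suc)
  from sums_unique2[OF this[unfolded fejer_power[OF t]] conv_exp_tent_sums] show ?thesis by (simp add: algebra_simps)
qed

text \<open>The double primitives of \<open>H\<close> and of the reflected \<open>conv_exp\<close>
  have equal second differences. Stating the result as a reflection requires no symmetry of
  \<open>conv_exp\<close>; the Hermitian symmetry of \<open>H\<close> turns it into a conjugate when
  the resolvent equation is conjugated.\<close>

lemma accelerant_eq:
  assumes H: "continuous_on UNIV H" and corr: "accelerant_corresponds H (exp_line_measure l)"
  shows "H x = conv_exp (- x)"
proof -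
  let ?\<sigma> = "exp_line_measure l"
  let ?\<rho> = "\<lambda>\<xi>. Re (exp (lhat \<xi>)) / (2 * pi)"
  have \<sigma>: "?\<sigma> = density lborel (\<lambda>\<xi>. ennreal (?\<rho> \<xi>))" by (simp add: exp_line_measure_def lhat_def)
  from corr obtain \<beta> where i\<sigma>: "integrable ?\<sigma> (\<lambda>\<xi>. 1 / (1 + \<xi>\<^sup>2))"
    and E: "\<And>x. of_real (\<bar>x\<bar> / 2) + (LBINT s=0..ereal x. of_real (x - s) * H s) = \<i> * of_real (\<beta> * x) + (LINT \<xi>|?\<sigma>. krein_kernel x \<xi>)"
    unfolding accelerant_corresponds_def by blast
  have ik: "integrable ?\<sigma> (krein_kernel x)" for x
  proof (rule Bochner_Integration.integrable_bound)
    show "integrable ?\<sigma> (\<lambda>\<xi>. (x\<^sup>2 + 2 * \<bar>x\<bar> + 4) * (1 / (1 + \<xi>\<^sup>2)))" by (intro integrable_mult_right i\<sigma>)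
    show "krein_kernel x \<in> borel_measurable ?\<sigma>" by (simp add: \<sigma>)
    show "AE \<xi> in ?\<sigma>. norm (krein_kernel x \<xi>) \<le> norm ((x\<^sup>2 + 2 * \<bar>x\<bar> + 4) * (1 / (1 + \<xi>\<^sup>2)))"
      unfolding real_norm_def times_divide_eq_right mult_1_right
      by (rule AE_I2, rule order_trans[OF krein_kernel_bound abs_ge_self])
  qed
  obtain H1 where H1: "\<And>x. (H1 has_vector_derivative H x) (at x)" and H1c: "continuous_on UNIV H1"
    using primitive_exists[OF H] by blast
  obtain H2 where H2: "\<And>x. (H2 has_vector_derivative H1 x) (at x)"
    using primitive_exists[OF H1c] by blast
  let ?K = "\<lambda>s. conv_exp (- s)"
  have K: "continuous_on UNIV ?K" by (intro continuous_on_compose2[OF conv_exp_cont] continuous_intros) auto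
  obtain K1 where K1: "\<And>x. (K1 has_vector_derivative ?K x) (at x)" and K1c: "continuous_on UNIV K1"
    using primitive_exists[OF K] by blast
  obtain K2 where K2: "\<And>x. (K2 has_vector_derivative K1 x) (at x)"
    using primitive_exists[OF K1c] by blast
  have P: "(LBINT s=0..ereal x. of_real (x - s) * H s) = H2 x - H2 0 - of_real x * H1 0" for x
    by (rule krein_double_primitive[OF H H1 H2])
  have "H2 (x + t) + H2 (x - t) - 2 * H2 x = K2 (x + t) + K2 (x - t) - 2 * K2 x" if t: "t \<ge> 0" for x t
  proof -
    have "(LINT \<xi>|?\<sigma>. krein_kernel (x + t) \<xi>) + (LINT \<xi>|?\<sigma>. krein_kernel (x - t) \<xi>) - 2 * (LINT \<xi>|?\<sigma>. krein_kernel x \<xi>)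
      = (LINT \<xi>|?\<sigma>. krein_kernel (x + t) \<xi> + krein_kernel (x - t) \<xi> - 2 * krein_kernel x \<xi>)"
      using ik by simp
    also have "\<dots> = (LINT \<xi>|lborel. ?\<rho> \<xi> *\<^sub>R (krein_kernel (x + t) \<xi> + krein_kernel (x - t) \<xi> - 2 * krein_kernel x \<xi>))"
      unfolding \<sigma>
    proof (rule integral_density)
      show "AE \<xi> in lborel. 0 \<le> ?\<rho> \<xi>"
        using exp_lhat(2) by (intro AE_I2 divide_nonneg_nonneg less_imp_le) auto
    qed measurable
    also have "\<dots> = (LINT \<xi>|lborel. fejer t \<xi> * exp (\<i> * of_real (\<xi> * x)) * exp (lhat \<xi>))"
    proof (rule integral_cong_AE)
      show "AE \<xi> in lborel. ?\<rho> \<xi> *\<^sub>R (krein_kernel (x + t) \<xi> + krein_kernel (x - t) \<xi> - 2 * krein_kernel x \<xi>)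
          = fejer t \<xi> * exp (\<i> * of_real (\<xi> * x)) * exp (lhat \<xi>)"
        using AE_lborel_singleton[of 0]
      proof eventually_elim
        case (elim \<xi>)
        have "?\<rho> \<xi> *\<^sub>R (of_real (2 * pi) * (fejer t \<xi> * exp (\<i> * of_real (\<xi> * x)))) =
          fejer t \<xi> * exp (\<i> * of_real (\<xi> * x)) * of_real (Re (exp (lhat \<xi>)))"
          by (simp add: scaleR_conv_of_real)
        then show ?case unfolding krein_kernel_second_difference[OF elim] by (simp only: exp_lhat(1)[symmetric])
      qed
      have [measurable]: "fejer t \<in> borel_measurable borel"
        using borel_measurable_integrable[OF fejer_integrable] by simp
      show "(\<lambda>\<xi>. fejer t \<xi> * exp (\<i> * of_real (\<xi> * x)) * exp (lhat \<xi>)) \<in> borel_measurable lborel" by measurable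
    qed measurable
    also have "\<dots> = tent t x + (LINT y|lborel. conv_exp y * tent t (x + y))" by (rule fejer_exp_lhat[OF t])
    also have "(LINT y|lborel. conv_exp y * tent t (x + y)) = (LINT s|lborel. ?K s * tent t (x - s))"
      using lborel_integral_real_affine[of "-1" "\<lambda>y. conv_exp y * tent t (x + y)" 0] by simp
    also have "\<dots> = K2 (x + t) + K2 (x - t) - 2 * K2 x" by (rule tent_integral_second_difference[OF K K1 K2 t])
    finally have second: "(LINT \<xi>|?\<sigma>. krein_kernel (x + t) \<xi>) + (LINT \<xi>|?\<sigma>. krein_kernel (x - t) \<xi>) - 2 * (LINT \<xi>|?\<sigma>. krein_kernel x \<xi>)
      = tent t x + (K2 (x + t) + K2 (x - t) - 2 * K2 x)" .
    have "\<bar>x + t\<bar> / 2 + \<bar>x - t\<bar> / 2 - 2 * (\<bar>x\<bar> / 2) = max 0 (t - \<bar>x\<bar>)"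
      using t by (auto simp: abs_if max_def field_simps)
    from arg_cong[OF this, of complex_of_real]
    have abs_second: "of_real (\<bar>x + t\<bar> / 2) + of_real (\<bar>x - t\<bar> / 2) - 2 * of_real (\<bar>x\<bar> / 2) = tent t x"
      unfolding tent_def of_real_add of_real_diff of_real_mult of_real_numeral .
    \<comment> \<open>Pure algebra: \<open>X\<close> stands for \<open>x\<close> and
      \<open>Y\<close> for \<open>t\<close>. The constant \<open>Z\<close> and the terms with
      \<open>W\<close> and \<open>b\<close> are affine in the evaluation point, so the second
      difference removes the base values of the primitives as well as \<beta>.\<close>
    have linear: "A1 + A2 - 2 * A3 = D" if
      "T1 + (A1 - Z - (X + Y) * W) = \<i> * (b * (X + Y)) + I1"
      "T2 + (A2 - Z - (X - Y) * W) = \<i> * (b * (X - Y)) + I2"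
      "T3 + (A3 - Z - X * W) = \<i> * (b * X) + I3"
      "I1 + I2 - 2 * I3 = T + D" "T1 + T2 - 2 * T3 = T"
      for A1 A2 A3 T1 T2 T3 Z X Y W b I1 I2 I3 T D :: complex
    proof -
      have "A1 + A2 - 2 * A3 = (T1 + (A1 - Z - (X + Y) * W)) + (T2 + (A2 - Z - (X - Y) * W)) - 2 * (T3 + (A3 - Z - X * W)) - (T1 + T2 - 2 * T3)"
        by (simp add: algebra_simps)
      also have "\<dots> = (I1 + I2 - 2 * I3) - T" unfolding that(1-3,5) by (simp add: algebra_simps)
      finally show ?thesis using that(4) by simp
    qed
    show ?thesis
      by (rule linear[OF E[of "x + t", unfolded P, unfolded of_real_mult of_real_add]
          E[of "x - t", unfolded P, unfolded of_real_mult of_real_diff] E[of x, unfolded P, unfolded of_real_mult] second abs_second])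
  qed
  from eq_from_tent_integrals[OF H1 H2 K1 K2 this] show ?thesis .
qed

end

section \<open>Convergence of the Nystrom method\<close>

context hermitian_cutoff
begin

text \<open>Differences of points of [0, R] stay within \<open>R\<close> of 0; the further shift by
  one mesh in the right-hand side of the discrete equation may add up to \<open>R\<close>, hence the
  range \<open>2 * R\<close>.\<close>

lemma conv_exp_modulus:
  assumes "e > 0"
  obtains d where "d > 0" "\<And>x y. \<bar>x\<bar> \<le> 2 * R \<Longrightarrow> \<bar>y\<bar> \<le> 2 * R \<Longrightarrow> \<bar>x - y\<bar> < d \<Longrightarrow> cmod (conv_exp x - conv_exp y) \<le> e"
proof -
  have "uniformly_continuous_on {-(2*R)..2*R} conv_exp"
    by (intro compact_uniformly_continuous continuous_on_subset[OF conv_exp_cont]) auto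
  then obtain d where "d > 0" "\<And>x y. x \<in> {-(2*R)..2*R} \<Longrightarrow> y \<in> {-(2*R)..2*R} \<Longrightarrow> dist y x < d \<Longrightarrow> dist (conv_exp y) (conv_exp x) < e"
    using assms unfolding uniformly_continuous_on_def by metis
  then show ?thesis by (intro that[of d]) (auto simp: dist_norm abs_le_iff less_imp_le)
qed

lemma mesh_eventually_less: "\<epsilon> > 0 \<Longrightarrow> \<forall>\<^sub>F n in sequentially. R / real n < \<epsilon>"
  using order_tendstoD(2)[OF mesh_tendsto_0] by blast

text \<open>The index \<open>p\<close> makes the statement uniform over an equicontinuous family: it is used for a single
  function in \<open>fredholm_bound\<close> and then for all \<open>r \<in> [0, R]\<close>.\<close>

lemma nystrom_consistent:
  fixes r :: "'i \<Rightarrow> real" and g :: "'i \<Rightarrow> real \<Rightarrow> complex"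
  assumes r: "\<And>p. p \<in> S \<Longrightarrow> 0 \<le> r p \<and> r p \<le> R"
    and cont: "\<And>p. p \<in> S \<Longrightarrow> continuous_on {0..r p} (g p)"
    and B: "\<And>p u. p \<in> S \<Longrightarrow> u \<in> {0..r p} \<Longrightarrow> cmod (g p u) \<le> B" and B0: "0 \<le> B"
    and equi: "\<And>e. e > 0 \<Longrightarrow> \<exists>d>0. \<forall>p\<in>S. \<forall>u\<in>{0..r p}. \<forall>v\<in>{0..r p}. \<bar>u - v\<bar> < d \<longrightarrow> cmod (g p u - g p v) \<le> e"
    and e: "e > 0"
  shows "\<forall>\<^sub>F n in sequentially. \<forall>p\<in>S. \<forall>j k. real j * (R / real n) \<le> r p \<longrightarrow> r p \<le> real (Suc j) * (R / real n) \<longrightarrow> k \<le> j \<longrightarrow>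
    cmod ((\<Sum>i<Suc j. of_real (R / real n) * (mesh_exp n (of_int (int k - int i) * (R / real n)) * g p (real i * (R / real n))))
      - integral {0..r p} (\<lambda>u. conv_exp (real k * (R / real n) - u) * g p u)) \<le> e"
proof -
  \<comment> \<open>The tolerance is divided into four: variation of the kernel (\<open>e1\<close>),
    variation of \<open>g\<close> (\<open>e2\<close>), replacement of \<open>mesh_exp\<close> by
    \<open>conv_exp\<close> (\<open>e3\<close>), and the surplus last node. The 8 in
    \<open>e3\<close> arises because j + 1 nodes have total weight up to \<open>2 * R\<close>; the
    summands 1 allow \<open>B\<close> or \<open>C\<close> to be 0.\<close>
  define e1 where "e1 = e / (4 * R * (B + 1))"
  define e2 where "e2 = e / (4 * R * (C + 1))"
  define e3 where "e3 = e / (8 * R * (B + 1))"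
  have e1: "e1 > 0" and e2: "e2 > 0" and e3: "e3 > 0"
    unfolding e1_def e2_def e3_def using e R_pos B0 C_nonneg by (auto intro!: divide_pos_pos mult_pos_pos)
  obtain d1 where d1: "d1 > 0" "\<And>x y. \<bar>x\<bar> \<le> 2 * R \<Longrightarrow> \<bar>y\<bar> \<le> 2 * R \<Longrightarrow> \<bar>x - y\<bar> < d1 \<Longrightarrow> cmod (conv_exp x - conv_exp y) \<le> e1"
    using conv_exp_modulus[OF e1] by blast
  obtain d2 where d2: "d2 > 0" "\<And>p u v. p \<in> S \<Longrightarrow> u \<in> {0..r p} \<Longrightarrow> v \<in> {0..r p} \<Longrightarrow> \<bar>u - v\<bar> < d2 \<Longrightarrow> cmod (g p u - g p v) \<le> e2"
    using equi[OF e2] by blast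
  have m1: "\<forall>\<^sub>F n in sequentially. R / real n < min d1 d2" using d1 d2 by (intro mesh_eventually_less) simp
  have m2: "\<forall>\<^sub>F n in sequentially. R / real n < e / (4 * (C * B + 1))"
    using e B0 C_nonneg by (intro mesh_eventually_less divide_pos_pos mult_pos_pos add_nonneg_pos mult_nonneg_nonneg) auto
  have m3: "\<forall>\<^sub>F n in sequentially. \<forall>x. dist (mesh_exp n x) (conv_exp x) < e3"
    using uniform_limitD[OF mesh_exp_limit e3] by simp
  show ?thesis using m1 m2 m3 eventually_ge_at_top[of 1]
  proof eventually_elim
    case (elim n)
    define h where "h = R / real n"
    have h: "h > 0" "h \<le> R" "h < d1" "h < d2" using elim(1,4) R_pos by (auto simp: h_def field_simps)
    show ?case unfolding h_def[symmetric]
    proof (intro ballI allI impI)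
      fix p j k assume p: "p \<in> S" and j: "real j * h \<le> r p" "r p \<le> real (Suc j) * h" and k: "k \<le> j"
      have "real k * h \<le> real j * h" using k h by (intro mult_right_mono) auto
      then have kr: "0 \<le> real k * h" "real k * h \<le> r p" using j(1) h(1) by (simp, linarith)
      let ?f = "\<lambda>u. conv_exp (real k * h - u) * g p u"
      have 1: "cmod (integral {0..r p} ?f - (\<Sum>i\<le>j. of_real h * ?f (real i * h))) \<le> r p * (e1 * B + C * e2) + h * (C * B)"
      proof (rule riemann_sum_error[OF h(1) j])
        show "continuous_on {0..r p} ?f"
          by (intro continuous_intros cont[OF p] continuous_on_compose2[OF conv_exp_cont]) auto
        show "cmod (?f u) \<le> C * B" if "u \<in> {0..r p}" for u
          unfolding norm_mult using that by (intro mult_mono conv_exp_bound B[OF p] C_nonneg norm_ge_zero)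
        fix u v assume uv: "u \<in> {0..r p}" "v \<in> {0..r p}" "\<bar>u - v\<bar> \<le> h"
        have "?f u - ?f v = (conv_exp (real k * h - u) - conv_exp (real k * h - v)) * g p u + conv_exp (real k * h - v) * (g p u - g p v)"
          by (simp add: algebra_simps)
        also have "cmod \<dots> \<le> e1 * B + C * e2"
        proof (rule norm_triangle_mono)
          have "cmod (conv_exp (real k * h - u) - conv_exp (real k * h - v)) \<le> e1"
            using uv kr r[OF p] h R_pos by (intro d1(2)) (simp_all only: atLeastAtMost_iff, linarith+)
          then show "cmod ((conv_exp (real k * h - u) - conv_exp (real k * h - v)) * g p u) \<le> e1 * B"
            unfolding norm_mult using uv e1 by (intro mult_mono B[OF p]) auto
          have "cmod (g p u - g p v) \<le> e2"
            using uv h by (intro d2(2)[OF p]) linarith+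
          then show "cmod (conv_exp (real k * h - v) * (g p u - g p v)) \<le> C * e2"
            unfolding norm_mult using e2 C_nonneg by (intro mult_mono conv_exp_bound) auto
        qed
        finally show "cmod (?f u - ?f v) \<le> e1 * B + C * e2" .
      qed
      have 2: "cmod (\<Sum>i\<le>j. of_real h * ((mesh_exp n (real k * h - real i * h) - conv_exp (real k * h - real i * h)) * g p (real i * h))) \<le> real (Suc j) * (h * (e3 * B))"
      proof -
        have "cmod (\<Sum>i\<le>j. of_real h * ((mesh_exp n (real k * h - real i * h) - conv_exp (real k * h - real i * h)) * g p (real i * h))) \<le> (\<Sum>i\<le>j. h * (e3 * B))"
        proof (rule sum_norm_le)
          fix i assume "i \<in> {..j}"
          then have "real i * h \<le> real j * h" using h by (intro mult_right_mono) auto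
          then have i: "real i * h \<in> {0..r p}" using j(1) h(1)
            by (simp only: atLeastAtMost_iff) (intro conjI mult_nonneg_nonneg; linarith)
          have "cmod (mesh_exp n (real k * h - real i * h) - conv_exp (real k * h - real i * h)) \<le> e3"
            using elim(3) by (simp add: dist_norm less_imp_le)
          then show "cmod (of_real h * ((mesh_exp n (real k * h - real i * h) - conv_exp (real k * h - real i * h)) * g p (real i * h))) \<le> h * (e3 * B)"
            unfolding norm_mult norm_of_real using h e3 B0 by (intro mult_mono B[OF p i]) auto
        qed
        then show ?thesis by simp
      qed
      have eq: "(\<Sum>i<Suc j. of_real h * (mesh_exp n (of_int (int k - int i) * h) * g p (real i * h))) - integral {0..r p} ?f
        = (\<Sum>i\<le>j. of_real h * ((mesh_exp n (real k * h - real i * h) - conv_exp (real k * h - real i * h)) * g p (real i * h)))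
          - (integral {0..r p} ?f - (\<Sum>i\<le>j. of_real h * ?f (real i * h)))"
        by (simp add: lessThan_Suc_atMost left_diff_distrib right_diff_distrib sum_subtractf)
      have "cmod ((\<Sum>i<Suc j. of_real h * (mesh_exp n (of_int (int k - int i) * h) * g p (real i * h))) - integral {0..r p} ?f)
        \<le> real (Suc j) * (h * (e3 * B)) + (r p * (e1 * B + C * e2) + h * (C * B))"
        unfolding eq by (rule order_trans[OF norm_triangle_ineq4 add_mono[OF 2 1]])
      also have "\<dots> \<le> e / 4 + (e / 4 + e / 4 + e / 4)"
      proof (intro add_mono)
        have "real (Suc j) * h \<le> 2 * R" using j(1) r[OF p] h(2) by (simp add: distrib_right)
        then have "real (Suc j) * h * (e3 * B) \<le> 2 * R * (e3 * (B + 1))"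
          by (rule mult_mono) (use e3 B0 R_pos in auto)
        also have "\<dots> = e / 4" using R_pos B0 by (simp add: e3_def divide_simps)
        finally show "real (Suc j) * (h * (e3 * B)) \<le> e / 4" by (simp only: mult.assoc)
        have "r p * (e1 * B) \<le> R * (e1 * (B + 1))" using r[OF p] e1 B0 by (intro mult_mono) auto
        also have "\<dots> = e / 4" using R_pos B0 by (simp add: e1_def divide_simps)
        finally have a: "r p * (e1 * B) \<le> e / 4" .
        have "r p * (C * e2) \<le> R * ((C + 1) * e2)" using r[OF p] e2 C_nonneg by (intro mult_mono) auto
        also have "\<dots> = e / 4" using R_pos C_nonneg by (simp add: e2_def divide_simps)
        finally have b: "r p * (C * e2) \<le> e / 4" .
        show "r p * (e1 * B + C * e2) \<le> e / 4 + e / 4" unfolding distrib_left using a b by linarith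
        have CB: "0 \<le> C * B" using C_nonneg B0 by simp
        have "h * (C * B) \<le> e / (4 * (C * B + 1)) * (C * B + 1)" using elim(2) h CB e by (intro mult_mono) (auto simp: h_def)
        also have "\<dots> = e / 4" using CB by (simp add: divide_simps)
        finally show "h * (C * B) \<le> e / 4" .
      qed
      finally show "cmod ((\<Sum>i<Suc j. of_real h * (mesh_exp n (of_int (int k - int i) * h) * g p (real i * h))) - integral {0..r p} ?f) \<le> e"
        by simp
    qed
  qed
qed

text \<open>The constant of \<open>toeplitz_stable\<close> with (j + 1)h replaced by its bound
  \<open>2 * R\<close>, valid when jh and \<open>h\<close> are both at most
  \<open>R\<close>.\<close>

definition stab :: real where "stab = 1 + C * exp N * (2 * R)"

lemma stab_ge_1: "1 \<le> stab"
  unfolding stab_def using C_nonneg R_pos by simp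

lemma toeplitz_stable_uniform:
  fixes v :: "nat \<Rightarrow> complex"
  assumes n: "n \<ge> 1" and J: "real J * (R / real n) \<le> 2 * R" and k: "k < J"
    and b: "\<And>k. k < J \<Longrightarrow> cmod (v k + (\<Sum>i<J. of_real (R / real n) * (mesh_exp n (of_int (int k - int i) * (R / real n)) * v i))) \<le> \<beta>"
  shows "cmod (v k) \<le> \<beta> * stab"
proof -
  have \<beta>: "0 \<le> \<beta>" using order_trans[OF norm_ge_zero b[OF k]] .
  have "cmod (v k) \<le> \<beta> * (1 + C * exp N * (real J * (R / real n)))" by (rule toeplitz_stable[OF n b k])
  also have "\<dots> \<le> \<beta> * stab" unfolding stab_def
    by (intro mult_left_mono add_left_mono J \<beta> mult_nonneg_nonneg C_nonneg exp_ge_zero)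
  finally show ?thesis .
qed

text \<open>Sampling \<open>g\<close> on ever finer grids transfers the discrete stability bound to the integral equation,
  with a constant that does not depend on \<open>r\<close>.\<close>

lemma fredholm_bound:
  fixes g f :: "real \<Rightarrow> complex"
  assumes r: "0 \<le> r" "r \<le> R" and g: "continuous_on {0..r} g"
    and eq: "\<And>t. t \<in> {0..r} \<Longrightarrow> g t + integral {0..r} (\<lambda>u. conv_exp (t - u) * g u) = f t"
    and f: "\<And>t. t \<in> {0..r} \<Longrightarrow> cmod (f t) \<le> \<beta>"
    and t: "t \<in> {0..r}"
  shows "cmod (g t) \<le> \<beta> * stab"
proof (rule field_le_epsilon)
  fix \<epsilon> :: real assume \<epsilon>: "\<epsilon> > 0"
  define e where "e = \<epsilon> / (stab + 1)"
  have "e * (stab + 1) = \<epsilon>" using stab_ge_1 by (simp add: e_def)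
  then have e: "e > 0" "e * stab + e = \<epsilon>" using stab_ge_1 \<epsilon> by (simp_all add: e_def distrib_left)
  have "compact (g ` {0..r})" by (intro compact_continuous_image g) auto
  then obtain B where B: "\<And>u. u \<in> {0..r} \<Longrightarrow> cmod (g u) \<le> B"
    by (meson bounded_iff compact_imp_bounded imageI)
  then have B0: "0 \<le> B" using order_trans[OF norm_ge_zero B[OF t]] by simp
  have uc: "uniformly_continuous_on {0..r} g" by (intro compact_uniformly_continuous g) auto
  have equi: "\<exists>d>0. \<forall>u\<in>{0..r}. \<forall>v\<in>{0..r}. \<bar>u - v\<bar> < d \<longrightarrow> cmod (g u - g v) \<le> e" if "e > 0" for e
    using uc that unfolding uniformly_continuous_on_def dist_norm real_norm_def by (meson less_imp_le)
  obtain d where d: "d > 0" "\<And>u v. u \<in> {0..r} \<Longrightarrow> v \<in> {0..r} \<Longrightarrow> \<bar>u - v\<bar> < d \<Longrightarrow> cmod (g u - g v) \<le> e"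
    using equi[OF e(1)] by blast
  have "\<forall>\<^sub>F n in sequentially. \<forall>p\<in>{()}. \<forall>j k. real j * (R / real n) \<le> r \<longrightarrow> r \<le> real (Suc j) * (R / real n) \<longrightarrow> k \<le> j \<longrightarrow>
    cmod ((\<Sum>i<Suc j. of_real (R / real n) * (mesh_exp n (of_int (int k - int i) * (R / real n)) * g (real i * (R / real n))))
      - integral {0..r} (\<lambda>u. conv_exp (real k * (R / real n) - u) * g u)) \<le> e"
    by (rule nystrom_consistent[where B = B]) (use r g B B0 equi e in auto)
  then have "\<forall>\<^sub>F n in sequentially. 1 \<le> n \<and> R / real n < d \<and> (\<forall>j k. real j * (R / real n) \<le> r \<longrightarrow> r \<le> real (Suc j) * (R / real n) \<longrightarrow> k \<le> j \<longrightarrow>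
    cmod ((\<Sum>i<Suc j. of_real (R / real n) * (mesh_exp n (of_int (int k - int i) * (R / real n)) * g (real i * (R / real n))))
      - integral {0..r} (\<lambda>u. conv_exp (real k * (R / real n) - u) * g u)) \<le> e)"
    using eventually_ge_at_top[of 1] mesh_eventually_less[OF d(1)] by eventually_elim blast
  then obtain n where n: "1 \<le> n" "R / real n < d" and cons: "\<And>j k. real j * (R / real n) \<le> r \<Longrightarrow> r \<le> real (Suc j) * (R / real n) \<Longrightarrow> k \<le> j \<Longrightarrow>
    cmod ((\<Sum>i<Suc j. of_real (R / real n) * (mesh_exp n (of_int (int k - int i) * (R / real n)) * g (real i * (R / real n))))
      - integral {0..r} (\<lambda>u. conv_exp (real k * (R / real n) - u) * g u)) \<le> e"
    using eventually_happens'[OF sequentially_bot] by blast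
  define h where "h = R / real n"
  have h: "h > 0" "h \<le> R" "h < d" using n R_pos by (auto simp: h_def field_simps)
  obtain j where j: "real j * h \<le> r" "r < real (Suc j) * h" using mesh_index[OF h(1) r(1)] by blast
  \<comment> \<open>The discrete bound is available only at grid points; the node just below
    \<open>t\<close> is within \<open>h\<close> of it, and the modulus of continuity of
    \<open>g\<close> covers the gap.\<close>
  obtain k where k: "real k * h \<le> t" "t < real (Suc k) * h" using mesh_index[OF h(1)] t by auto
  have "real k * h < real (Suc j) * h" using k(1) t j(2) by simp
  then have kj: "k < Suc j" using h(1) by simp
  have grid: "real i * h \<in> {0..r}" if "i < Suc j" for i
  proof -
    have "real i * h \<le> real j * h" using that h by (intro mult_right_mono) auto
    then show ?thesis using j(1) h(1) by (simp only: atLeastAtMost_iff) (intro conjI mult_nonneg_nonneg; linarith)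
  qed
  have "cmod (g (real k * h)) \<le> (\<beta> + e) * stab"
  proof (rule toeplitz_stable_uniform[OF n(1) _ kj, unfolded h_def[symmetric]])
    show "real (Suc j) * h \<le> 2 * R" using j(1) r(2) h(2) by (simp add: distrib_right)
    fix k assume k: "k < Suc j"
    have "g (real k * h) + (\<Sum>i<Suc j. of_real h * (mesh_exp n (of_int (int k - int i) * h) * g (real i * h))) =
      f (real k * h) + ((\<Sum>i<Suc j. of_real h * (mesh_exp n (of_int (int k - int i) * h) * g (real i * h))) - integral {0..r} (\<lambda>u. conv_exp (real k * h - u) * g u))"
      unfolding eq[OF grid[OF k], symmetric] by simp
    also have "cmod \<dots> \<le> \<beta> + e"
      using k j by (intro norm_triangle_mono f grid cons[unfolded h_def[symmetric]]) auto
    finally show "cmod (g (real k * h) + (\<Sum>i<Suc j. of_real h * (mesh_exp n (of_int (int k - int i) * h) * g (real i * h)))) \<le> \<beta> + e" .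
  qed
  moreover have "cmod (g t - g (real k * h)) \<le> e"
    using t grid[OF kj] k h by (intro d(2)) (auto simp: distrib_right)
  ultimately have "cmod (g t) \<le> (\<beta> + e) * stab + e"
    using norm_triangle_ineq2[of "g t" "g (real k * h)"] by linarith
  also have "\<dots> = \<beta> * stab + \<epsilon>" using e(2) by (simp add: distrib_right)
  finally show "cmod (g t) \<le> \<beta> * stab + \<epsilon>" .
qed

text \<open>The samples of \<open>\<gamma> r\<close> solve the discrete system up to three
  residuals: the quadrature error, the shift of the right-hand side from (k-j)h to (k-j-1)h, and the
  replacement of \<open>conv_exp\<close> by \<open>mesh_exp\<close>. Stability bounds every
  coordinate of the difference; only coordinate 0 is kept, since it carries the Krein coefficient on
  one side and the Verblunsky parameter on the other.\<close>

lemma nystrom_converges: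
  fixes \<gamma> :: "real \<Rightarrow> real \<Rightarrow> complex"
  assumes cont: "\<And>r. r \<in> {0..R} \<Longrightarrow> continuous_on {0..r} (\<gamma> r)"
    and eq: "\<And>r t. r \<in> {0..R} \<Longrightarrow> t \<in> {0..r} \<Longrightarrow> \<gamma> r t + integral {0..r} (\<lambda>u. conv_exp (t - u) * \<gamma> r u) = conv_exp (t - r)"
    and \<epsilon>: "\<epsilon> > 0"
  shows "\<forall>\<^sub>F n in sequentially. \<forall>j s. real (Suc j) * (R / real n) \<le> R \<longrightarrow>
    (\<forall>k<Suc j. s k + (\<Sum>i<Suc j. of_real (R / real n) * (mesh_exp n (of_int (int k - int i) * (R / real n)) * s i))
         = mesh_exp n (of_int (int k - int (Suc j)) * (R / real n))) \<longrightarrow>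
    cmod (\<gamma> (real j * (R / real n)) 0 - s 0) \<le> \<epsilon>"
proof -
  define B where "B = C * stab"
  have B0: "0 \<le> B" using C_nonneg stab_ge_1 by (simp add: B_def)
  have B: "cmod (\<gamma> r u) \<le> B" if "r \<in> {0..R}" "u \<in> {0..r}" for r u
    unfolding B_def by (rule fredholm_bound[OF _ _ cont eq conv_exp_bound]) (use that in auto)
  \<comment> \<open>Equicontinuity in \<open>r\<close> is read off the equation itself:
    \<open>\<gamma> r u - \<gamma> r v\<close> is a difference of values of \<open>conv_exp\<close>
    minus the integral of such differences against \<open>\<gamma> r\<close>, which is bounded by
    \<open>B\<close>. Hence the factor \<open>1 + R * B\<close>.\<close>
  have equi: "\<exists>d>0. \<forall>r\<in>{0..R}. \<forall>u\<in>{0..r}. \<forall>v\<in>{0..r}. \<bar>u - v\<bar> < d \<longrightarrow> cmod (\<gamma> r u - \<gamma> r v) \<le> e" if e: "e > 0" for e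
  proof -
    define e' where "e' = e / (1 + R * B)"
    have RB: "0 < 1 + R * B" using R_pos B0 by (intro add_pos_nonneg) auto
    then have "e' * (1 + R * B) = e" by (simp add: e'_def)
    moreover have "e' + (e' * B) * R = e' * (1 + R * B)" by (simp add: algebra_simps)
    moreover have "e' > 0" unfolding e'_def using e RB by (rule divide_pos_pos)
    ultimately have e': "e' > 0" "e' + (e' * B) * R = e" by simp_all
    obtain d where d: "d > 0" "\<And>x y. \<bar>x\<bar> \<le> 2 * R \<Longrightarrow> \<bar>y\<bar> \<le> 2 * R \<Longrightarrow> \<bar>x - y\<bar> < d \<Longrightarrow> cmod (conv_exp x - conv_exp y) \<le> e'"
      using conv_exp_modulus[OF e'(1)] by blast
    have "cmod (\<gamma> r u - \<gamma> r v) \<le> e" if "r \<in> {0..R}" "u \<in> {0..r}" "v \<in> {0..r}" "\<bar>u - v\<bar> < d" for r u v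
    proof -
      have c: "continuous_on {0..r} (\<lambda>w. conv_exp (u - w) * \<gamma> r w)" for u
        by (intro continuous_intros cont that continuous_on_compose2[OF conv_exp_cont]) auto
      have "\<gamma> r u - \<gamma> r v = (conv_exp (u - r) - conv_exp (v - r)) - integral {0..r} (\<lambda>w. (conv_exp (u - w) - conv_exp (v - w)) * \<gamma> r w)"
      proof -
        have "integral {0..r} (\<lambda>w. (conv_exp (u - w) - conv_exp (v - w)) * \<gamma> r w) = integral {0..r} (\<lambda>w. conv_exp (u - w) * \<gamma> r w) - integral {0..r} (\<lambda>w. conv_exp (v - w) * \<gamma> r w)"
          unfolding left_diff_distrib by (intro integral_diff integrable_continuous_real c)
        then show ?thesis unfolding eq[OF that(1,2), symmetric] eq[OF that(1,3), symmetric] by simp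
      qed
      also have "cmod \<dots> \<le> e' + (e' * B) * (r - 0)"
      proof (rule order_trans[OF norm_triangle_ineq4 add_mono])
        show "cmod (conv_exp (u - r) - conv_exp (v - r)) \<le> e'" using that by (intro d(2)) auto
        show "cmod (integral {0..r} (\<lambda>w. (conv_exp (u - w) - conv_exp (v - w)) * \<gamma> r w)) \<le> (e' * B) * (r - 0)"
        proof (rule integral_bound)
          show "continuous_on {0..r} (\<lambda>w. (conv_exp (u - w) - conv_exp (v - w)) * \<gamma> r w)"
            unfolding left_diff_distrib by (intro continuous_on_diff c)
          show "cmod ((conv_exp (u - w) - conv_exp (v - w)) * \<gamma> r w) \<le> e' * B" if w: "w \<in> {0..r}" for w
            unfolding norm_mult using that \<open>r \<in> {0..R}\<close> \<open>u \<in> {0..r}\<close> \<open>v \<in> {0..r}\<close> \<open>\<bar>u - v\<bar> < d\<close> e'(1)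
            by (intro mult_mono d(2) B) auto
        qed (use that in auto)
      qed
      also have "\<dots> \<le> e' + (e' * B) * R" using that e'(1) B0 by (intro add_left_mono mult_left_mono) auto
      also have "\<dots> = e" by (rule e'(2))
      finally show ?thesis .
    qed
    then show ?thesis using d(1) by blast
  qed
  define e where "e = \<epsilon> / (3 * stab)"
  have e: "e > 0" "(e + e + e) * stab = \<epsilon>" using stab_ge_1 \<epsilon> by (auto simp: e_def)
  obtain d where d: "d > 0" "\<And>x y. \<bar>x\<bar> \<le> 2 * R \<Longrightarrow> \<bar>y\<bar> \<le> 2 * R \<Longrightarrow> \<bar>x - y\<bar> < d \<Longrightarrow> cmod (conv_exp x - conv_exp y) \<le> e"
    using conv_exp_modulus[OF e(1)] by blast
  have cons: "\<forall>\<^sub>F n in sequentially. \<forall>r\<in>{0..R}. \<forall>j k. real j * (R / real n) \<le> r \<longrightarrow> r \<le> real (Suc j) * (R / real n) \<longrightarrow> k \<le> j \<longrightarrow>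
    cmod ((\<Sum>i<Suc j. of_real (R / real n) * (mesh_exp n (of_int (int k - int i) * (R / real n)) * \<gamma> r (real i * (R / real n))))
      - integral {0..r} (\<lambda>u. conv_exp (real k * (R / real n) - u) * \<gamma> r u)) \<le> e"
    by (rule nystrom_consistent[where r = "\<lambda>r. r" and g = \<gamma>, OF _ cont B B0 equi e(1)]) auto
  have lim: "\<forall>\<^sub>F n in sequentially. \<forall>x. dist (mesh_exp n x) (conv_exp x) < e"
    using uniform_limitD[OF mesh_exp_limit e(1)] by simp
  show ?thesis using cons lim mesh_eventually_less[OF d(1)] eventually_ge_at_top[of 1]
  proof eventually_elim
    case (elim n)
    define h where "h = R / real n"
    have h: "h > 0" "h \<le> R" "h < d" using elim R_pos by (auto simp: h_def field_simps)
    show ?case unfolding h_def[symmetric]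
    proof (intro allI impI)
      fix j s
      assume j: "real (Suc j) * h \<le> R"
        and s: "\<forall>k<Suc j. s k + (\<Sum>i<Suc j. of_real h * (mesh_exp n (of_int (int k - int i) * h) * s i)) = mesh_exp n (of_int (int k - int (Suc j)) * h)"
      let ?r = "real j * h"
      have r: "?r \<in> {0..R}" "?r + h \<le> R" using j h by (auto simp: distrib_right)
      let ?v = "\<lambda>i. \<gamma> ?r (real i * h) - s i"
      have "cmod (?v 0) \<le> (e + e + e) * stab"
      proof (rule toeplitz_stable_uniform[where n = n and J = "Suc j", unfolded h_def[symmetric]])
        fix k assume k: "k < Suc j"
        then have "real k * h \<le> real j * h" using h by (intro mult_right_mono) auto
        then have kh: "real k * h \<in> {0..?r}" using h by simp
        let ?I = "integral {0..?r} (\<lambda>u. conv_exp (real k * h - u) * \<gamma> ?r u)"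
        let ?S = "\<lambda>w. \<Sum>i<Suc j. of_real h * (mesh_exp n (of_int (int k - int i) * h) * w i)"
        let ?y = "of_int (int k - int (Suc j)) * h"
        have split: "g - sk + (S1 - S2) = (S1 - I) + (L1 - Ly) + (Ly - D)" if "sk + S2 = D" "g + I = L1"
          for g sk S1 S2 I L1 Ly D :: complex
          unfolding that[symmetric] by simp
        have S: "?S ?v = ?S (\<lambda>i. \<gamma> ?r (real i * h)) - ?S s"
          by (simp only: right_diff_distrib sum_subtractf)
        have "s k + ?S s = mesh_exp n ?y" using s k by blast
        moreover have "\<gamma> ?r (real k * h) + ?I = conv_exp (real k * h - ?r)" by (rule eq[OF r(1) kh])
        ultimately have "?v k + ?S ?v = (?S (\<lambda>i. \<gamma> ?r (real i * h)) - ?I) + (conv_exp (real k * h - ?r) - conv_exp ?y) + (conv_exp ?y - mesh_exp n ?y)"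
          unfolding S by (rule split)
        also have "cmod \<dots> \<le> e + e + e"
        proof (intro norm_triangle_mono)
          show "cmod (?S (\<lambda>i. \<gamma> ?r (real i * h)) - ?I) \<le> e"
            using elim(1)[unfolded h_def[symmetric]] r k h by (auto simp: distrib_right)
          have y: "?y = real k * h - ?r - h" by (simp add: algebra_simps)
          show "cmod (conv_exp (real k * h - ?r) - conv_exp ?y) \<le> e"
            unfolding y using kh r h R_pos by (intro d(2)) (simp_all only: atLeastAtMost_iff, linarith+)
          show "cmod (conv_exp ?y - mesh_exp n ?y) \<le> e"
            using elim(2) by (auto simp: dist_norm norm_minus_commute intro: less_imp_le)
        qed
        finally show "cmod (?v k + ?S ?v) \<le> e + e + e" .
      qed (use elim j R_pos in auto)
      then show "cmod (\<gamma> ?r 0 - s 0) \<le> \<epsilon>" unfolding e(2) by simp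
    qed
  qed
qed

end

section \<open>Verblunsky parameters and the Krein coefficient\<close>

lemma integral_circle_measure_with_density:
  fixes f :: "complex \<Rightarrow> complex"
  assumes [measurable]: "w \<in> borel_measurable borel" "f \<in> borel_measurable borel" and w: "\<And>\<theta>. 0 \<le> w \<theta>"
  shows "(LINT z|circle_measure_with_density w. f z) = (LINT \<theta>|lborel. (w \<theta> * indicator {0..<2*pi} \<theta>) *\<^sub>R f (cis \<theta>))"
proof -
  have "circle_measure_with_density w = distr (density lborel (\<lambda>\<theta>. ennreal (w \<theta> * indicator {0..<2*pi} \<theta>))) borel cis"
    unfolding circle_measure_with_density_def
    by (intro arg_cong[where f = "\<lambda>M. distr M borel cis"] arg_cong[where f = "density lborel"] ext) (auto split: split_indicator)
  moreover have "(LINT z|distr (density lborel (\<lambda>\<theta>. ennreal (w \<theta> * indicator {0..<2*pi} \<theta>))) borel cis. f z)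
     = (LINT \<theta>|density lborel (\<lambda>\<theta>. ennreal (w \<theta> * indicator {0..<2*pi} \<theta>)). f (cis \<theta>))"
    by (intro integral_distr) measurable
  moreover have "\<dots> = (LINT \<theta>|lborel. (w \<theta> * indicator {0..<2*pi} \<theta>) *\<^sub>R f (cis \<theta>))"
    by (intro integral_density) (use w in auto)
  ultimately show ?thesis by simp
qed

text \<open>The recurrence is given only for z \<noteq> 0, so it is evaluated at 0 as a limit. The
  constant term of the reversed polynomial is the conjugate of the leading coefficient, which is
  1.\<close>

lemma verblunsky_constant_coeff:
  assumes p: "degree p = n" "lead_coeff p = 1"
    and rec: "\<And>z. z \<noteq> 0 \<Longrightarrow> poly q z = z * poly p z - cnj a * reversed_poly n p z"
  shows "coeff q 0 = - cnj a"
proof -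
  let ?r = "\<lambda>z. \<Sum>i\<le>n. cnj (coeff p i) * z ^ (n - i)"
  have r: "reversed_poly n p z = ?r z" if "z \<noteq> 0" for z
  proof -
    have "z ^ n * (cnj (coeff p i) * inverse z ^ i) = cnj (coeff p i) * z ^ (n - i)" if "i \<le> n" for i
      using \<open>z \<noteq> 0\<close> that by (simp add: power_diff power_inverse divide_inverse)
    then have "(\<Sum>i\<le>n. z ^ n * (cnj (coeff p i) * inverse z ^ i)) = ?r z" by (intro sum.cong) auto
    then show ?thesis by (simp add: reversed_poly_def poly_altdef p sum_distrib_left)
  qed
  have "((\<lambda>z. z * poly p z - cnj a * ?r z) \<longlongrightarrow> 0 * poly p 0 - cnj a * ?r 0) (at 0)"
    by (intro tendsto_intros poly_isCont[unfolded isCont_def])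
  moreover have "\<forall>\<^sub>F z in at 0. z * poly p z - cnj a * ?r z = poly q z"
    unfolding eventually_at_filter using rec r by simp
  ultimately have "(poly q \<longlongrightarrow> 0 * poly p 0 - cnj a * ?r 0) (at 0)"
    by (rule Lim_transform_eventually)
  moreover have "(poly q \<longlongrightarrow> poly q 0) (at 0)" by (rule poly_isCont[unfolded isCont_def])
  ultimately have "poly q 0 = 0 * poly p 0 - cnj a * ?r 0"
    using tendsto_unique[OF at_neq_bot] by blast
  moreover have "?r 0 = cnj (coeff p n)"
  proof -
    have "?r 0 = (\<Sum>i\<le>n. if i = n then cnj (coeff p i) else 0)"
      by (rule sum.cong) (auto simp: power_0_left)
    then show ?thesis by simp
  qed
  ultimately show ?thesis using p by (simp add: poly_0_coeff_0)
qed

context hermitian_cutoff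
begin

lemma exp_circle_measure_eq: "exp_circle_measure l R n = circle_measure_with_density (weight n)"
  unfolding exp_circle_measure_def Let_def weight_def[abs_def] exponent_def ..

text \<open>The factor 2 pi reflects that \<open>moment\<close> is normalized and the circle measure
  is not; it is harmless for orthogonality.\<close>

lemma orthogonality_moments:
  assumes n: "n \<ge> 1"
  shows "(LINT z|exp_circle_measure l R n. poly p z * cnj (z ^ k)) = 2 * pi * (\<Sum>i\<le>degree p. coeff p i * moment n (int k - int i))"
proof -
  have w: "0 \<le> weight n \<theta>" for \<theta> using weight_bounds(1)[OF n, of \<theta>] exp_ge_zero order_trans by blast
  have int: "integrable lborel (\<lambda>\<theta>. circle_char k \<theta> * exp (exponent n \<theta>))" for k
    by (rule circle_char_mult_integrable[where B = "exp N"]) (use w weight_bounds[OF n] in \<open>auto simp: exp_exponent\<close>)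
  have [measurable]: "(\<lambda>z. poly p z * cnj (z ^ k)) \<in> borel_measurable borel"
    by (intro borel_measurable_continuous_onI continuous_intros)
  have "(LINT z|exp_circle_measure l R n. poly p z * cnj (z ^ k)) =
    (LINT \<theta>|lborel. (weight n \<theta> * indicator {0..<2*pi} \<theta>) *\<^sub>R (poly p (cis \<theta>) * cnj (cis \<theta> ^ k)))"
    unfolding exp_circle_measure_eq by (rule integral_circle_measure_with_density[OF _ _ w]) measurable
  also have "\<dots> = (LINT \<theta>|lborel. 2 * pi * (\<Sum>i\<le>degree p. coeff p i * (circle_char (int k - int i) \<theta> * exp (exponent n \<theta>))))"
  proof (rule Bochner_Integration.integral_cong)
    fix \<theta>
    have "(weight n \<theta> * indicator {0..<2*pi} \<theta>) *\<^sub>R (coeff p i * cis \<theta> ^ i * cnj (cis \<theta> ^ k)) =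
      2 * pi * (coeff p i * (circle_char (int k - int i) \<theta> * exp (exponent n \<theta>)))" for i
      unfolding circle_char_mult_cnj[symmetric] exp_exponent
      by (simp add: circle_char_def Complex.DeMoivre scaleR_conv_of_real)
    then show "(weight n \<theta> * indicator {0..<2*pi} \<theta>) *\<^sub>R (poly p (cis \<theta>) * cnj (cis \<theta> ^ k)) =
      2 * pi * (\<Sum>i\<le>degree p. coeff p i * (circle_char (int k - int i) \<theta> * exp (exponent n \<theta>)))"
      unfolding poly_altdef sum_distrib_right sum_distrib_left scaleR_sum_right by (intro sum.cong refl)
  qed simp
  also have "\<dots> = 2 * pi * (\<Sum>i\<le>degree p. coeff p i * moment n (int k - int i))"
    unfolding moment_def using int by simp
  finally show ?thesis .
qed

text \<open>Orthogonality to z^k for k \<le> j gives j + 1 equations for the j + 1 lower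
  coefficients of P_{j+1}, and the leading coefficient 1 supplies the right-hand side. Every term
  then contains a factor \<open>h\<close>, so the coefficients are rescaled by -1/h.\<close>

lemma verblunsky_toeplitz:
  assumes n: "n \<ge> 1" and a: "verblunsky_parameters (exp_circle_measure l R n) a"
  shows "\<exists>s. (\<forall>k<Suc j. s k + (\<Sum>i<Suc j. of_real (R / real n) * (mesh_exp n (of_int (int k - int i) * (R / real n)) * s i))
         = mesh_exp n (of_int (int k - int (Suc j)) * (R / real n))) \<and> s 0 = cnj (a j / of_real (R / real n))"
proof -
  let ?h = "R / real n"
  have h: "complex_of_real ?h \<noteq> 0" using n R_pos by simp
  obtain P where P: "monic_orthogonal_polys (exp_circle_measure l R n) P"
    and rec: "\<And>n z. z \<noteq> 0 \<Longrightarrow> poly (P (Suc n)) z = z * poly (P n) z - cnj (a n) * reversed_poly n (P n) z"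
    using a unfolding verblunsky_parameters_def by blast
  have deg: "degree (P m) = m" "lead_coeff (P m) = 1"
    and orth: "k < m \<Longrightarrow> (LINT z|exp_circle_measure l R n. poly (P m) z * cnj (z ^ k)) = 0" for m k
    using P unfolding monic_orthogonal_polys_def by blast+
  let ?p = "coeff (P (Suc j))"
  define s where "s i = - ?p i / of_real ?h" for i
  have p: "?p i = - of_real ?h * s i" for i using h by (simp add: s_def)
  show ?thesis
  proof (intro exI conjI allI impI)
    have "?p 0 = - cnj (a j)" by (rule verblunsky_constant_coeff[OF deg rec])
    then show "s 0 = cnj (a j / of_real ?h)" by (simp add: s_def)
  next
    fix k assume k: "k < Suc j"
    let ?S = "\<Sum>i<Suc j. of_real ?h * (mesh_exp n (of_int (int k - int i) * ?h) * s i)"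
    let ?b = "mesh_exp n (of_int (int k - int (Suc j)) * ?h)"
    have "0 = (\<Sum>i\<le>Suc j. ?p i * moment n (int k - int i))"
      using orth[OF k] unfolding orthogonality_moments[OF n] deg by simp
    also have "\<dots> = (\<Sum>i<Suc j. ?p i * moment n (int k - int i)) + moment n (int k - int (Suc j))"
      using deg(2)[of "Suc j"] unfolding deg by (simp only: lessThan_Suc_atMost[symmetric] sum.lessThan_Suc mult_1_left)
    \<comment> \<open>Since k < j + 1, the index is nonzero and the Kronecker term of the moment is
      absent.\<close>
    also have "moment n (int k - int (Suc j)) = of_real ?h * ?b"
      using k by (simp only: moment_eq[OF n]) simp
    also have "(\<Sum>i<Suc j. ?p i * moment n (int k - int i)) = (\<Sum>i<Suc j. (if k = i then ?p i else 0) + ?p i * (of_real ?h * mesh_exp n (of_int (int k - int i) * ?h)))"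
      by (rule sum.cong) (auto simp: moment_eq[OF n] distrib_left)
    also have "\<dots> = ?p k + (\<Sum>i<Suc j. ?p i * (of_real ?h * mesh_exp n (of_int (int k - int i) * ?h)))"
      using k by (simp only: sum.distrib sum.delta' finite_lessThan lessThan_iff if_True)
    also have "\<dots> = - of_real ?h * (s k + ?S)"
      unfolding p distrib_left sum_distrib_left by (simp only: mult_ac)
    finally have eq: "0 = - of_real ?h * (s k + ?S) + of_real ?h * ?b" .
    have cancel: "x = y" if "0 = - c * x + c * y" "c \<noteq> 0" for c x y :: complex
      using that by (metis add_eq_0_iff minus_minus mult_cancel_left mult_minus_left)
    show "s k + ?S = ?b" by (rule cancel[OF eq h])
  qed
qed

text \<open>The second variable of the kernel is frozen at \<open>r\<close>, leaving a Fredholm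
  equation in \<open>t\<close> alone, whose value at t = 0 is the conjugate of the Krein
  coefficient. By Hermitian symmetry the conjugate of \<open>H\<close> is
  \<open>conv_exp\<close>.\<close>

lemma resolvent_kernel_cnj:
  assumes H: "continuous_on UNIV H" "hermitian_fun H" "\<And>x. H x = conv_exp (- x)"
    and \<Gamma>: "resolvent_kernel H r \<Gamma>" and r: "0 \<le> r"
  shows "continuous_on {0..r} (\<lambda>t. cnj (\<Gamma> t r))"
    and "t \<in> {0..r} \<Longrightarrow> cnj (\<Gamma> t r) + integral {0..r} (\<lambda>u. conv_exp (t - u) * cnj (\<Gamma> u r)) = conv_exp (t - r)"
proof -
  have c\<Gamma>: "continuous_on {0..r} (\<lambda>t. \<Gamma> t r)"
  proof -
    have "continuous_on ({0..r} \<times> {0..r}) (\<lambda>(t, s). \<Gamma> t s)" using \<Gamma> by (simp add: resolvent_kernel_def)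
    then have "continuous_on {0..r} (\<lambda>t. case (t, r) of (t, s) \<Rightarrow> \<Gamma> t s)"
      by (rule continuous_on_compose2) (use r in \<open>auto intro!: continuous_intros\<close>)
    then show ?thesis by simp
  qed
  then show "continuous_on {0..r} (\<lambda>t. cnj (\<Gamma> t r))" by (intro continuous_intros)
  assume t: "t \<in> {0..r}"
  have HL: "cnj (H x) = conv_exp x" for x
    using H(2) H(3)[of "- x"] by (simp add: hermitian_fun_def)
  have "continuous_on {0..r} (\<lambda>u. H (t - u) * \<Gamma> u r)"
    by (intro continuous_intros c\<Gamma> continuous_on_compose2[OF H(1)]) auto
  then have "(LINT u:{0..r}|lborel. H (t - u) * \<Gamma> u r) = integral {0..r} (\<lambda>u. H (t - u) * \<Gamma> u r)"
    by (intro set_borel_integral_eq_integral borel_integrable_atLeastAtMost')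
  moreover have "\<Gamma> t r + (LINT u:{0..r}|lborel. H (t - u) * \<Gamma> u r) = H (t - r)"
    using \<Gamma> t r by (auto simp: resolvent_kernel_def)
  ultimately have "cnj (\<Gamma> t r + integral {0..r} (\<lambda>u. H (t - u) * \<Gamma> u r)) = cnj (H (t - r))" by simp
  then show "cnj (\<Gamma> t r) + integral {0..r} (\<lambda>u. conv_exp (t - u) * cnj (\<Gamma> u r)) = conv_exp (t - r)"
    by (simp add: HL Henstock_Kurzweil_Integration.integral_cnj)
qed

end

theorem theorem9p4:
  fixes R :: real and l :: "real \<Rightarrow> complex" and A :: "real \<Rightarrow> complex"
    and a :: "nat \<Rightarrow> nat \<Rightarrow> complex" and \<delta> :: real
  assumes "R > 0"
    and "continuous_on UNIV l"
    and "hermitian_fun l"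
    and "closure {x. l x \<noteq> 0} \<subseteq> {- R..R}"
    and "krein_coefficient (exp_line_measure l) A"
    and "\<forall>\<^sub>F n in sequentially. verblunsky_parameters (exp_circle_measure l R n) (a n)"
    and "0 < \<delta>" and "\<delta> < R"
  shows "(\<lambda>n. SUP j \<in> {j :: nat. \<delta> < real j * (R / real n) \<and> real j * (R / real n) < R}.
            cmod (A (real j * (R / real n)) - a n j / of_real (R / real n)))
         \<longlonglongrightarrow> 0"
proof -
  have supp: "l x = 0" if "R \<le> \<bar>x\<bar>" for x
  proof -
    \<comment> \<open>The set where \<open>l\<close> is nonzero is open, hence contained in the
      interior of [-R, R]; so \<open>l\<close> vanishes at the two endpoints as well.\<close>
    have "open {x. l x \<noteq> 0}"
      using open_vimage[OF _ assms(2), of "- {0}"] by (simp add: vimage_def open_Compl)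
    then have "{x. l x \<noteq> 0} \<subseteq> interior {- R..R}"
      by (rule interior_maximal[OF order_trans[OF closure_subset assms(4)]])
    then have "x \<notin> {- R<..<R} \<Longrightarrow> l x = 0" unfolding interior_atLeastAtMost_real by blast
    then show ?thesis using that by (simp add: abs_if split: if_splits)
  qed
  have "compact (l ` {- R..R})"
    by (intro compact_continuous_image continuous_on_subset[OF assms(2)]) auto
  then obtain M where M: "\<And>x. x \<in> {- R..R} \<Longrightarrow> cmod (l x) \<le> M"
    by (meson bounded_iff compact_imp_bounded imageI)
  interpret hermitian_cutoff R M l
  proof
    have "0 \<le> M" using order_trans[OF norm_ge_zero M[of 0]] assms(1) by simp
    then show "cmod (l x) \<le> M" for x
      using M[of x] supp[of x] by (cases "\<bar>x\<bar> \<le> R") (auto simp: abs_le_iff)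
    show "l (- x) = cnj (l x)" for x using assms(3) by (simp only: hermitian_fun_def)
  qed (fact assms supp)+
  obtain H where H: "continuous_on UNIV H" "accelerant H" "accelerant_corresponds H (exp_line_measure l)"
    and \<Gamma>: "\<And>r. r \<ge> 0 \<Longrightarrow> \<exists>\<Gamma>. resolvent_kernel H r \<Gamma> \<and> A r = \<Gamma> 0 r"
    using assms(5) unfolding krein_coefficient_def by blast
  then have "\<forall>r\<in>{0..}. \<exists>\<Gamma>. resolvent_kernel H r \<Gamma> \<and> A r = \<Gamma> 0 r" by simp
  from bchoice[OF this] obtain G where G: "\<And>r. r \<ge> 0 \<Longrightarrow> resolvent_kernel H r (G r)" "\<And>r. r \<ge> 0 \<Longrightarrow> A r = G r 0 r"
    by auto
  have herm: "hermitian_fun H" using H(2) by (simp add: accelerant_def)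
  note HL = accelerant_eq[OF H(1,3)]
  define \<gamma> where "\<gamma> r t = cnj (G r t r)" for r t
  have conv: "\<forall>\<^sub>F n in sequentially. \<forall>j s. real (Suc j) * (R / real n) \<le> R \<longrightarrow>
    (\<forall>k<Suc j. s k + (\<Sum>i<Suc j. of_real (R / real n) * (mesh_exp n (of_int (int k - int i) * (R / real n)) * s i))
         = mesh_exp n (of_int (int k - int (Suc j)) * (R / real n))) \<longrightarrow>
    cmod (\<gamma> (real j * (R / real n)) 0 - s 0) \<le> \<epsilon>" if "\<epsilon> > 0" for \<epsilon>
  proof (rule nystrom_converges[OF _ _ that])
    fix r assume "r \<in> {0..R}"
    then have r: "0 \<le> r" by simp
    show "continuous_on {0..r} (\<gamma> r)"
      unfolding \<gamma>_def by (rule resolvent_kernel_cnj(1)[OF H(1) herm HL G(1)[OF r] r])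
    show "\<gamma> r t + integral {0..r} (\<lambda>u. conv_exp (t - u) * \<gamma> r u) = conv_exp (t - r)" if "t \<in> {0..r}" for t
      unfolding \<gamma>_def by (rule resolvent_kernel_cnj(2)[OF H(1) herm HL G(1)[OF r] r that])
  qed
  show ?thesis
  proof (rule tendstoI)
    fix e :: real assume e: "e > 0"
    \<comment> \<open>This puts j = n - 1, for which jh = R - h, into the index set, so the supremum
      is taken over a nonempty set.\<close>
    have "\<forall>\<^sub>F n in sequentially. R / real n < R - \<delta>" using assms(8) by (intro mesh_eventually_less) simp
    moreover have "e / 2 > 0" using e by simp
    note conv[OF this]
    ultimately
    show "\<forall>\<^sub>F n in sequentially. dist (SUP j \<in> {j :: nat. \<delta> < real j * (R / real n) \<and> real j * (R / real n) < R}.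
            cmod (A (real j * (R / real n)) - a n j / of_real (R / real n))) 0 < e"
      using assms(6) eventually_ge_at_top[of 1]
    proof eventually_elim
      case (elim n)
      define h where "h = R / real n"
      have h: "h > 0" "h < R - \<delta>" "real n * h = R" using elim(1,4) assms(1) unfolding h_def by simp_all
      let ?J = "{j :: nat. \<delta> < real j * h \<and> real j * h < R}"
      let ?f = "\<lambda>j. cmod (A (real j * h) - a n j / of_real h)"
      have bound: "?f j \<le> e / 2" if "j \<in> ?J" for j
      proof -
        \<comment> \<open>Because \<open>R\<close> is itself the grid point nh, jh < R leaves room
          for a full further mesh, which the shifted right-hand side requires.\<close>
        have "real j * h < real n * h" using that h(3) by simp
        then have "Suc j \<le> n" using h(1) by simp
        then have "real (Suc j) * h \<le> real n * h" using h(1) by (intro mult_right_mono) auto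
        then have j: "real (Suc j) * h \<le> R" using h(3) by simp
        obtain s where s: "\<forall>k<Suc j. s k + (\<Sum>i<Suc j. of_real h * (mesh_exp n (of_int (int k - int i) * h) * s i))
            = mesh_exp n (of_int (int k - int (Suc j)) * h)" "s 0 = cnj (a n j / of_real h)"
          using verblunsky_toeplitz[OF elim(4,3), of j, folded h_def] by (elim exE conjE)
        have "cmod (\<gamma> (real j * h) 0 - s 0) \<le> e / 2"
          by (rule elim(2)[folded h_def, rule_format, OF j, OF s(1)[rule_format]])
        moreover have "\<gamma> (real j * h) 0 - s 0 = cnj (A (real j * h) - a n j / of_real h)"
          using h(1) by (simp add: \<gamma>_def s(2) G(2))
        ultimately show ?thesis by (simp only: complex_mod_cnj)
      qed
      have "real (n - 1) * h = R - h" using h(3) elim(4) by (simp only: of_nat_diff of_nat_1 left_diff_distrib mult_1_left)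
      then have "n - 1 \<in> ?J" using h(1,2) by simp
      then have ne: "?J \<noteq> {}" by blast
      have "(SUP j\<in>?J. ?f j) \<le> e / 2" by (rule cSUP_least[OF ne bound])
      moreover have "0 \<le> (SUP j\<in>?J. ?f j)"
        by (rule order_trans[OF norm_ge_zero cSUP_upper[OF \<open>n - 1 \<in> ?J\<close> bdd_aboveI2[OF bound]]])
      ultimately show ?case using e unfolding h_def[symmetric] dist_real_def by linarith
    qed
  qed
qed

end
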